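(* Let $(G,S,\beta,\gamma,h)$ satisfy condition (D), let $(G,* )$ be the groupoid obtained from $(G,\cdot)$ by the dihedral construction, let $A=\langle h\rangle$ be the subloop of $S$ generated by $h$, and let $Q=(G,\cdot)/A=(G,* )/A$. Define $\varphi:Q\to\operatorname{Aut}A$ by $a^{\varphi(yA)}=a^{(-1)^r}$ for $y\in G_r$, $r\in\{0,1\}$. Let $\pi:Q\to G$ be a transversal (i.e. $\pi(xA)\in xA$ for all $x\in G$) with $\pi(A)=1$, and for $x,y\in G$ let $\tau(xA,yA)$ be an integer with $\pi((xy)A)=\pi(xA)\pi(yA)h^{\tau(xA,yA)}$. Define $\eta,\eta^*:Q\times Q\to A$ by $$\eta(xA,yA)=h^{-\tau(xA,yA)},\qquad \eta^*(xA,yA)=\eta(xA,yA)\,h^{(-1)^r\sigma(i+j)},$$ where $x\in\alpha^i\cup e\alpha^i$, $y\in(\alpha^j\cup\alpha^jf)\cap G_r$, $i,j\in M$, $r\in\{0,1\}$. Then the Moufang factor sets $(\varphi,\eta)$ and $(\varphi,\eta^* )$ differ by an associative factor set $(\varphi,\mu)$ (that is, $\eta^*=\eta+\mu$, written additively in $A$) which satisfies $$\mu\big((u\cdot vw)^{-1},\,uv\cdot w\big)=\mu\big(u\cdot vw,\,(u\cdot vw)^{-1}\big)^{\varphi(uv\cdot w)}\quad\text{for all }u,v,w\in Q.$$ Consequently: $(G,* )$ is a Moufang loop; the associators in $(G,\cdot)$ and $(G,* )$ coincide (for all $x,y,z\in G$ the associator $[x,y,z]$ computed in $(G,\cdot)$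 equals the one computed in $(G,* )$); the associator subloops $A(G,\cdot)$ and $A(G,* )$ coincide as loops (same set and same multiplication); and the nuclei $N(G,\cdot)$ and $N(G,* )$ coincide as sets.
   Context: A Moufang loop is a loop satisfying $((xy)x)z=x(y(xz))$. In a loop, the associator $[x,y,z]$ is the unique $w$ with $(xy)z=(x(yz))w$ and the commutator $[x,y]$ is the unique $w$ with $xy=(yx)w$. For a Moufang loop $G$: $N(G)=\{x:[x,y,z]=1\ \forall y,z\}$ (nucleus), $Z(G)=\{x:[x,y]=[x,y,z]=1\ \forall y,z\}$ (center). The associator subloop $A(L)$ of a loop $L$ is the subloop generated by all associators. Let $m\ge 1$ be an integer and $M=\{-m+1,-m+2,\dots,m\}$. Define $\sigma:\mathbb Z\to\{-1,0,1\}$ by $\sigma(i)=1$ if $i>m$, $\sigma(i)=0$ if $i\in M$, $\sigma(i)=-1$ if $i<1-m$. Condition (D) for $(G,S,\beta,\gamma,h)$: $G$ is a Moufang loop; $S\unlhd G$ and $G/S$ is a dihedral group of order $4m$ (for $m=1$ this means the Klein four-group $V_4$); $\beta,\gamma$ are involutions of $G/S$ such that $\alpha=\beta\gamma$ has order $2m$; with $G_0=\bigcup_{i\in M}\alpha^i$ and $G_1=G\setminus G_0$, one has $1\neq h\in S\cap Z(G_0)\cap N(G)$ and $hxh=x$ for some (equivalently every) $x\in G_1$. Choose $e\in\beta$, $f\in\gamma$; then $G$ is the disjoint union $\bigcup_{i\in M}(\alpha^i\cup e\alpha^i)$ and also the disjoint union $\bigcup_{j\in M}(\alpha^j\cup\alpha^jf)$.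 The dihedral construction defines $x*y=xy\,h^{(-1)^r\sigma(i+j)}$ for $x\in\alpha^i\cup e\alpha^i$, $y\in(\alpha^j\cup\alpha^jf)\cap G_r$, $i,j\in M$, $r\in\{0,1\}$ (independent of the choice of $e,f$). The subloop $A=\langle h\rangle$ is normal in both $(G,\cdot)$ and $(G,* )$, and the two quotients are equal. Factor sets: let $Q$ be a Moufang loop, $A$ an abelian group (written additively in the definitions below), $\varphi:Q\to\operatorname{Aut}A$ a homomorphism acting on the right, $a\mapsto a^{\varphi(x)}$, and $\eta:Q\times Q\to A$. The pair $(\varphi,\eta)$ is a factor set if $\eta(x,1)=\eta(1,x)=0$ for all $x\in Q$. It is associative if $\eta(x,y)^{\varphi(z)}+\eta(xy,z)=\eta(y,z)+\eta(x,yz)$ for all $x,y,z\in Q$, and Moufang if $\eta(x,y)^{\varphi(xz)}+\eta(xy,x)^{\varphi(z)}+\eta(xy\cdot x,z)=\eta(x,z)+\eta(y,xz)+\eta(x,y\cdot xz)$ for all $x,y,z\in Q$. The sum of factor sets is $(\varphi,\eta)+(\varphi,\mu)=(\varphi,\eta+\mu)$ with pointwise addition. In the claim the group $A=\langle h\rangle$ is written multiplicatively. The notation $u\cdot vw$ means $u(vw)$, and $uv\cdot w$ means $(uv)w$. *)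

theory Defs
  imports "HOL-Algebra.Multiplicative_Group"
begin

section \<open>Moufang loops\<close>

text \<open>
  Loops are carried by the record type of \<^theory>\<open>HOL-Algebra.Group\<close>. The operations defined
  there for an arbitrary record are reused without associativity: cosets, the set product, the
  quotient \<open>G Mod S\<close>, \<^const>\<open>iso\<close>, \<^const>\<open>m_inv\<close> and integer powers. Integer powers and inverses
  have their usual meaning in Moufang loops, since these are diassociative.
\<close>

locale loop =
  fixes L (structure)
  assumes one_in: "\<one> \<in> carrier L"
    and mult_in: "\<lbrakk>x \<in> carrier L; y \<in> carrier L\<rbrakk> \<Longrightarrow> x \<otimes> y \<in> carrier L"
    and left_one: "x \<in> carrier L \<Longrightarrow> \<one> \<otimes> x = x"
    and right_one: "x \<in> carrier L \<Longrightarrow> x \<otimes> \<one> = x"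
    and left_division:
      "\<lbrakk>a \<in> carrier L; b \<in> carrier L\<rbrakk> \<Longrightarrow> \<exists>!x. x \<in> carrier L \<and> a \<otimes> x = b"
    and right_division:
      "\<lbrakk>a \<in> carrier L; b \<in> carrier L\<rbrakk> \<Longrightarrow> \<exists>!y. y \<in> carrier L \<and> y \<otimes> a = b"

locale moufang_loop = loop +
  assumes moufang:
    "\<lbrakk>x \<in> carrier L; y \<in> carrier L; z \<in> carrier L\<rbrakk>
      \<Longrightarrow> ((x \<otimes> y) \<otimes> x) \<otimes> z = x \<otimes> (y \<otimes> (x \<otimes> z))"

definition associator :: "('a, 'b) monoid_scheme \<Rightarrow> 'a \<Rightarrow> 'a \<Rightarrow> 'a \<Rightarrow> 'a" where
  "associator L x y z =
    (THE w. w \<in> carrier L \<and>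
      (x \<otimes>\<^bsub>L\<^esub> y) \<otimes>\<^bsub>L\<^esub> z = (x \<otimes>\<^bsub>L\<^esub> (y \<otimes>\<^bsub>L\<^esub> z)) \<otimes>\<^bsub>L\<^esub> w)"

definition commutator :: "('a, 'b) monoid_scheme \<Rightarrow> 'a \<Rightarrow> 'a \<Rightarrow> 'a" where
  "commutator L x y = (THE w. w \<in> carrier L \<and> x \<otimes>\<^bsub>L\<^esub> y = (y \<otimes>\<^bsub>L\<^esub> x) \<otimes>\<^bsub>L\<^esub> w)"

definition nucleus :: "('a, 'b) monoid_scheme \<Rightarrow> 'a set" where
  "nucleus L =
    {x \<in> carrier L. \<forall>y\<in>carrier L. \<forall>z\<in>carrier L. associator L x y z = \<one>\<^bsub>L\<^esub>}"

definition loop_center :: "('a, 'b) monoid_scheme \<Rightarrow> 'a set" where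
  "loop_center L =
    {x \<in> carrier L. \<forall>y\<in>carrier L. \<forall>z\<in>carrier L.
       commutator L x y = \<one>\<^bsub>L\<^esub> \<and> associator L x y z = \<one>\<^bsub>L\<^esub>}"

definition subloop :: "'a set \<Rightarrow> ('a, 'b) monoid_scheme \<Rightarrow> bool" where
  "subloop H L \<longleftrightarrow> H \<subseteq> carrier L \<and> loop (L\<lparr>carrier := H\<rparr>)"

definition subloop_generated :: "('a, 'b) monoid_scheme \<Rightarrow> 'a set \<Rightarrow> 'a set" where
  "subloop_generated L X = \<Inter>{H. subloop H L \<and> X \<subseteq> H}"

definition associator_subloop :: "('a, 'b) monoid_scheme \<Rightarrow> 'a set" where
  "associator_subloop L =
    subloop_generated L {associator L x y z | x y z.
      x \<in> carrier L \<and> y \<in> carrier L \<and> z \<in> carrier L}"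

definition normal_subloop :: "'a set \<Rightarrow> ('a, 'b) monoid_scheme \<Rightarrow> bool" where
  "normal_subloop S L \<longleftrightarrow> subloop S L \<and>
    (\<forall>x\<in>carrier L. \<forall>y\<in>carrier L.
       x <#\<^bsub>L\<^esub> S = S #>\<^bsub>L\<^esub> x \<and>
       x <#\<^bsub>L\<^esub> (y <#\<^bsub>L\<^esub> S) = (x \<otimes>\<^bsub>L\<^esub> y) <#\<^bsub>L\<^esub> S \<and>
       (S #>\<^bsub>L\<^esub> x) #>\<^bsub>L\<^esub> y = S #>\<^bsub>L\<^esub> (x \<otimes>\<^bsub>L\<^esub> y))"


section \<open>Factor sets\<close>

text \<open>
  The abelian group \<open>A\<close> is written multiplicatively. The action is on the right, so
  \<open>\<phi> x a\<close> stands for \<open>a\<close> to the power \<open>\<phi>(x)\<close>, and a homomorphism into the automorphisms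
  satisfies \<open>\<phi> (x y) a = \<phi> y (\<phi> x a)\<close>.
\<close>

definition factor_set ::
  "('q, 'c) monoid_scheme \<Rightarrow> ('a, 'b) monoid_scheme \<Rightarrow> ('q \<Rightarrow> 'a \<Rightarrow> 'a) \<Rightarrow> ('q \<Rightarrow> 'q \<Rightarrow> 'a) \<Rightarrow> bool"
where
  "factor_set Q A \<phi> \<eta> \<longleftrightarrow>
     moufang_loop Q \<and> comm_group A \<and>
     (\<forall>x\<in>carrier Q. \<phi> x \<in> iso A A) \<and>
     (\<forall>x\<in>carrier Q. \<forall>y\<in>carrier Q. \<forall>a\<in>carrier A. \<phi> (x \<otimes>\<^bsub>Q\<^esub> y) a = \<phi> y (\<phi> x a)) \<and>
     \<eta> \<in> carrier Q \<rightarrow> carrier Q \<rightarrow> carrier A \<and>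
     (\<forall>x\<in>carrier Q. \<eta> x \<one>\<^bsub>Q\<^esub> = \<one>\<^bsub>A\<^esub> \<and> \<eta> \<one>\<^bsub>Q\<^esub> x = \<one>\<^bsub>A\<^esub>)"

definition associative_factor_set ::
  "('q, 'c) monoid_scheme \<Rightarrow> ('a, 'b) monoid_scheme \<Rightarrow> ('q \<Rightarrow> 'a \<Rightarrow> 'a) \<Rightarrow> ('q \<Rightarrow> 'q \<Rightarrow> 'a) \<Rightarrow> bool"
where
  "associative_factor_set Q A \<phi> \<eta> \<longleftrightarrow> factor_set Q A \<phi> \<eta> \<and>
     (\<forall>x\<in>carrier Q. \<forall>y\<in>carrier Q. \<forall>z\<in>carrier Q.
        \<phi> z (\<eta> x y) \<otimes>\<^bsub>A\<^esub> \<eta> (x \<otimes>\<^bsub>Q\<^esub> y) z =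
        \<eta> y z \<otimes>\<^bsub>A\<^esub> \<eta> x (y \<otimes>\<^bsub>Q\<^esub> z))"

definition moufang_factor_set ::
  "('q, 'c) monoid_scheme \<Rightarrow> ('a, 'b) monoid_scheme \<Rightarrow> ('q \<Rightarrow> 'a \<Rightarrow> 'a) \<Rightarrow> ('q \<Rightarrow> 'q \<Rightarrow> 'a) \<Rightarrow> bool"
where
  "moufang_factor_set Q A \<phi> \<eta> \<longleftrightarrow> factor_set Q A \<phi> \<eta> \<and>
     (\<forall>x\<in>carrier Q. \<forall>y\<in>carrier Q. \<forall>z\<in>carrier Q.
        \<phi> (x \<otimes>\<^bsub>Q\<^esub> z) (\<eta> x y) \<otimes>\<^bsub>A\<^esub> \<phi> z (\<eta> (x \<otimes>\<^bsub>Q\<^esub> y) x)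
          \<otimes>\<^bsub>A\<^esub> \<eta> ((x \<otimes>\<^bsub>Q\<^esub> y) \<otimes>\<^bsub>Q\<^esub> x) z =
        \<eta> x z \<otimes>\<^bsub>A\<^esub> \<eta> y (x \<otimes>\<^bsub>Q\<^esub> z) \<otimes>\<^bsub>A\<^esub> \<eta> x (y \<otimes>\<^bsub>Q\<^esub> (x \<otimes>\<^bsub>Q\<^esub> z)))"


section \<open>The dihedral construction\<close>

text \<open>
  The dihedral group of order \<open>2 n\<close> as the semidirect product of the integers modulo \<open>n\<close> with a
  group of order 2: \<open>(a, s)\<close> stands for the product \<open>\<rho>\<^sup>a \<tau>\<^sup>s\<close> of powers of a rotation and a
  reflection.
  For \<open>n = 2\<close> this is the Klein four-group.
\<close>

definition dihedral_group :: "nat \<Rightarrow> (int \<times> bool) monoid" where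
  "dihedral_group n =
    \<lparr>carrier = {0..<int n} \<times> UNIV,
     mult = (\<lambda>(a, s) (b, t). ((a + (if s then - b else b)) mod int n, s \<noteq> t)),
     one = (0, False)\<rparr>"

definition involution :: "('a, 'b) monoid_scheme \<Rightarrow> 'a \<Rightarrow> bool" where
  "involution D x \<longleftrightarrow> x \<in> carrier D \<and> x \<noteq> \<one>\<^bsub>D\<^esub> \<and> x \<otimes>\<^bsub>D\<^esub> x = \<one>\<^bsub>D\<^esub>"

definition index_range :: "nat \<Rightarrow> int set" where
  "index_range m = {- int m + 1..int m}"

definition dih_sigma :: "nat \<Rightarrow> int \<Rightarrow> int" where
  "dih_sigma m i = (if i > int m then 1 else if i < 1 - int m then - 1 else 0)"

text \<open>
  The powers of \<open>\<alpha>\<close> are taken in \<open>G Mod S\<close>, so each of them is a subset of \<open>G\<close>.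
  \<open>dih_part G S m \<alpha> r\<close> is \<open>G\<^sub>r\<close> for \<open>r \<in> {0, 1}\<close>.
\<close>

definition dih_part :: "('a, 'b) monoid_scheme \<Rightarrow> 'a set \<Rightarrow> nat \<Rightarrow> 'a set \<Rightarrow> nat \<Rightarrow> 'a set" where
  "dih_part G S m \<alpha> r =
    (let G0 = (\<Union>i\<in>index_range m. \<alpha> [^]\<^bsub>G Mod S\<^esub> i)
     in if r = 0 then G0 else carrier G - G0)"

locale dihedral_condition = moufang_loop G for G (structure) +
  fixes S :: "'a set" and m :: nat and \<beta> \<gamma> :: "'a set" and h :: 'a
  assumes m_ge_1: "m \<ge> 1"
    and S_normal: "normal_subloop S G"
    and quotient_dihedral: "G Mod S \<cong> dihedral_group (2 * m)"
    and beta_involution: "involution (G Mod S) \<beta>"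
    and gamma_involution: "involution (G Mod S) \<gamma>"
    and alpha_order: "group.ord (G Mod S) (\<beta> \<otimes>\<^bsub>G Mod S\<^esub> \<gamma>) = 2 * m"
    and h_not_one: "h \<noteq> \<one>"
    and h_in_S: "h \<in> S"
    and h_central:
      "h \<in> loop_center (G\<lparr>carrier := dih_part G S m (\<beta> \<otimes>\<^bsub>G Mod S\<^esub> \<gamma>) 0\<rparr>)"
    and h_nuclear: "h \<in> nucleus G"
    and h_inverted: "\<exists>x\<in>dih_part G S m (\<beta> \<otimes>\<^bsub>G Mod S\<^esub> \<gamma>) 1. (h \<otimes> x) \<otimes> h = x"

definition left_block ::
  "('a, 'b) monoid_scheme \<Rightarrow> 'a set \<Rightarrow> 'a set \<Rightarrow> 'a \<Rightarrow> int \<Rightarrow> 'a set" where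
  "left_block G S \<alpha> e i =
    (\<alpha> [^]\<^bsub>G Mod S\<^esub> i) \<union> (e <#\<^bsub>G\<^esub> (\<alpha> [^]\<^bsub>G Mod S\<^esub> i))"

definition right_block ::
  "('a, 'b) monoid_scheme \<Rightarrow> 'a set \<Rightarrow> 'a set \<Rightarrow> 'a \<Rightarrow> int \<Rightarrow> 'a set" where
  "right_block G S \<alpha> f j =
    (\<alpha> [^]\<^bsub>G Mod S\<^esub> j) \<union> ((\<alpha> [^]\<^bsub>G Mod S\<^esub> j) #>\<^bsub>G\<^esub> f)"

text \<open>
  The triple \<open>(i, j, r)\<close> is an admissible index for \<open>(x, y)\<close>. Under the above condition, with
  \<open>\<alpha> = \<beta> \<gamma>\<close>, \<open>e \<in> \<beta>\<close> and \<open>f \<in> \<gamma>\<close>, there is exactly one such triple for all \<open>x\<close>, \<open>y\<close> in \<open>G\<close>.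
\<close>

definition dih_index ::
  "('a, 'b) monoid_scheme \<Rightarrow> 'a set \<Rightarrow> nat \<Rightarrow> 'a set \<Rightarrow> 'a \<Rightarrow> 'a \<Rightarrow> 'a \<Rightarrow> 'a \<Rightarrow> int \<Rightarrow> int \<Rightarrow> nat \<Rightarrow> bool"
where
  "dih_index G S m \<alpha> e f x y i j r \<longleftrightarrow>
     i \<in> index_range m \<and> j \<in> index_range m \<and> r \<in> {0, 1} \<and>
     x \<in> left_block G S \<alpha> e i \<and> y \<in> right_block G S \<alpha> f j \<inter> dih_part G S m \<alpha> r"

text \<open>
  \<open>dih_mult\<close>, \<open>dih_action\<close> and \<open>dih_eta_star\<close> below are specified by all admissible indices and all coset representatives
  at once, so that their independence of such choices is not presupposed by the definitions.
\<close>

definition dih_mult ::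
  "('a, 'b) monoid_scheme \<Rightarrow> 'a set \<Rightarrow> nat \<Rightarrow> 'a set \<Rightarrow> 'a \<Rightarrow> 'a \<Rightarrow> 'a \<Rightarrow> 'a \<Rightarrow> 'a \<Rightarrow> 'a"
where
  "dih_mult G S m \<alpha> e f h x y =
    (THE z. \<forall>i j r. dih_index G S m \<alpha> e f x y i j r \<longrightarrow>
       z = (x \<otimes>\<^bsub>G\<^esub> y) \<otimes>\<^bsub>G\<^esub> (h [^]\<^bsub>G\<^esub> ((- 1) ^ r * dih_sigma m (i + j))))"

definition dihedral_construction ::
  "('a, 'b) monoid_scheme \<Rightarrow> 'a set \<Rightarrow> nat \<Rightarrow> 'a set \<Rightarrow> 'a \<Rightarrow> 'a \<Rightarrow> 'a \<Rightarrow> ('a, 'b) monoid_scheme"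
where
  "dihedral_construction G S m \<alpha> e f h = G\<lparr>mult := dih_mult G S m \<alpha> e f h\<rparr>"

definition dih_action ::
  "('a, 'b) monoid_scheme \<Rightarrow> 'a set \<Rightarrow> nat \<Rightarrow> 'a set \<Rightarrow> 'a set \<Rightarrow> 'a set \<Rightarrow> 'a \<Rightarrow> 'a"
where
  "dih_action G S m \<alpha> A Y a =
    (THE b. \<forall>y\<in>carrier G. \<forall>r\<in>{0, 1}.
       Y = y <#\<^bsub>G\<^esub> A \<and> y \<in> dih_part G S m \<alpha> r \<longrightarrow>
       b = a [^]\<^bsub>G\<^esub> ((- 1) ^ r :: int))"

definition dih_eta_star ::
  "('a, 'b) monoid_scheme \<Rightarrow> 'a set \<Rightarrow> nat \<Rightarrow> 'a set \<Rightarrow> 'a \<Rightarrow> 'a \<Rightarrow> 'a \<Rightarrow> 'a set \<Rightarrow>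
    ('a set \<Rightarrow> 'a set \<Rightarrow> 'a) \<Rightarrow> 'a set \<Rightarrow> 'a set \<Rightarrow> 'a"
where
  "dih_eta_star G S m \<alpha> e f h A \<eta> X Y =
    (THE b. \<forall>x\<in>carrier G. \<forall>y\<in>carrier G. \<forall>i j r.
       X = x <#\<^bsub>G\<^esub> A \<and> Y = y <#\<^bsub>G\<^esub> A \<and> dih_index G S m \<alpha> e f x y i j r \<longrightarrow>
       b = \<eta> X Y \<otimes>\<^bsub>G\<^esub> (h [^]\<^bsub>G\<^esub> ((- 1) ^ r * dih_sigma m (i + j))))"

end

theory Submission
  imports Defs
begin

text \<open>
  Let \<open>k(x) \<in> M\<close> and \<open>\<epsilon>(x) = \<plusminus>1\<close> be such that \<open>x S = \<beta>\<^sup>s \<alpha>\<^bsup>k(x)\<^esup>\<close> with \<open>\<epsilon>(x) = (-1)\<^sup>s\<close>. The block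
  index of \<open>y\<close> on the right is \<open>k(y)\<close> if \<open>\<epsilon>(y) = 1\<close> and \<open>1 - k(y)\<close> otherwise, and the exponent
  \<open>c(x, y) = (-1)\<^sup>r \<sigma>(i + j)\<close> satisfies \<open>2m c(x, y) = \<epsilon>(y) k(x) + k(y) - k(xy)\<close>. Hence \<open>2m c\<close> is a
  coboundary for the action of \<open>G/S\<close> on the integers by \<open>\<epsilon>\<close>, although \<open>c\<close> itself need not be one.
  This gives the associative and the Moufang cocycle identities for \<open>c\<close>. Since \<open>h\<close> is nuclear and
  \<open>h x = x h\<^bsup>\<epsilon>(x)\<^esup>\<close>, these identities transfer the Moufang law and the associators, which lie in
  \<open>S\<close>, from \<open>x y\<close> to \<open>x y h\<^bsup>c(x, y)\<^esup>\<close>.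
\<close>

section \<open>Nuclear elements of Moufang loops\<close>

text \<open>The map \<open>kap\<close> picks integer representatives for residues modulo 2m, so it
  is additive, up to the sign twist, only modulo 2m; \<sigma> records the carry. This is why 2m
  times the carry is a coboundary. Division by 2m is harmless in the integers but not in
  \<open>A\<close>, where h may have finite order. Hence the identities for c are proved between
  integers and only then used as exponents of h. The given \<open>\<eta>\<close> behaves
  differently: \<open>\<tau>\<close> matters only modulo the order of h, so its Moufang identity
  holds only between powers of h. Since G/S is a group, \<open>kap\<close> and \<open>eps\<close> do
  not see bracketing, and c vanishes as soon as one argument lies in S. So multiplying by an element
  of S is the same in both loops; this fixes the associators and the subloop they generate. The
  condition on \<open>\<mu>\<close> has the same origin: uv.w and u.vw differ by an associator,
  which c ignores. As G is not associative, group laws are available only for nuclear elements. They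
  cover the powers of h, and all other calculations are done with elements written as x h^a.\<close>

context loop
begin

lemma left_cancel:
  assumes "a \<in> carrier L" "x \<in> carrier L" "y \<in> carrier L" "a \<otimes> x = a \<otimes> y"
  shows "x = y"
  using left_division[of a "a \<otimes> x"] assms mult_in by metis

lemma right_cancel:
  assumes "a \<in> carrier L" "x \<in> carrier L" "y \<in> carrier L" "x \<otimes> a = y \<otimes> a"
  shows "x = y"
  using right_division[of a "x \<otimes> a"] assms mult_in by metis

lemma associator_unique:
  assumes "x \<in> carrier L" "y \<in> carrier L" "z \<in> carrier L" "w \<in> carrier L"
    and "(x \<otimes> y) \<otimes> z = (x \<otimes> (y \<otimes> z)) \<otimes> w"
  shows "associator L x y z = w"
  unfolding associator_def
  using assms by (intro the_equality) (auto intro: left_cancel[of "x \<otimes> (y \<otimes> z)"] simp: mult_in)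

lemma associator_ex:
  assumes "x \<in> carrier L" "y \<in> carrier L" "z \<in> carrier L"
  shows "associator L x y z \<in> carrier L"
    and "(x \<otimes> y) \<otimes> z = (x \<otimes> (y \<otimes> z)) \<otimes> associator L x y z"
proof -
  obtain w where w: "w \<in> carrier L" "(x \<otimes> (y \<otimes> z)) \<otimes> w = (x \<otimes> y) \<otimes> z"
    using ex1_implies_ex[OF left_division[of "x \<otimes> (y \<otimes> z)" "(x \<otimes> y) \<otimes> z"]] assms
    by (auto simp: mult_in)
  moreover from this have "associator L x y z = w"
    using assms by (intro associator_unique) auto
  ultimately show "associator L x y z \<in> carrier L"
    "(x \<otimes> y) \<otimes> z = (x \<otimes> (y \<otimes> z)) \<otimes> associator L x y z"
    by simp_all
qed

lemma associator_eq_one_iff: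
  assumes "x \<in> carrier L" "y \<in> carrier L" "z \<in> carrier L"
  shows "associator L x y z = \<one> \<longleftrightarrow> (x \<otimes> y) \<otimes> z = x \<otimes> (y \<otimes> z)"
proof
  assume "associator L x y z = \<one>"
  then show "(x \<otimes> y) \<otimes> z = x \<otimes> (y \<otimes> z)"
    using associator_ex(2)[OF assms] assms by (simp add: right_one mult_in)
qed (use associator_unique[OF assms one_in] assms in \<open>simp add: right_one mult_in\<close>)

text \<open>Left cancellation alone makes a two-sided inverse unique, so the definite description
  behind \<open>m_inv\<close> has the right value without associativity.\<close>

lemma m_inv_eqI:
  assumes "x \<in> carrier L" "y \<in> carrier L" "x \<otimes> y = \<one>" "y \<otimes> x = \<one>"
  shows "inv x = y"
  unfolding m_inv_def
  using assms by (intro the_equality) (auto intro: left_cancel[of x])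

text \<open>All three positions in an associator are required here, whereas \<open>nucleus\<close>
  controls only the first one. In Moufang loops the two sets agree, by
  \<open>nucleus_eq_nuclear\<close>.\<close>

definition nuclear :: "'a set" where
  "nuclear = {a \<in> carrier L. \<forall>x\<in>carrier L. \<forall>y\<in>carrier L.
     (a \<otimes> x) \<otimes> y = a \<otimes> (x \<otimes> y) \<and> (x \<otimes> a) \<otimes> y = x \<otimes> (a \<otimes> y) \<and>
     (x \<otimes> y) \<otimes> a = x \<otimes> (y \<otimes> a)}"

lemma nuclearD:
  assumes "a \<in> nuclear"
  shows "a \<in> carrier L"
    and "\<lbrakk>x \<in> carrier L; y \<in> carrier L\<rbrakk> \<Longrightarrow> (a \<otimes> x) \<otimes> y = a \<otimes> (x \<otimes> y)"
    and "\<lbrakk>x \<in> carrier L; y \<in> carrier L\<rbrakk> \<Longrightarrow> (x \<otimes> a) \<otimes> y = x \<otimes> (a \<otimes> y)"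
    and "\<lbrakk>x \<in> carrier L; y \<in> carrier L\<rbrakk> \<Longrightarrow> (x \<otimes> y) \<otimes> a = x \<otimes> (y \<otimes> a)"
  using assms unfolding nuclear_def by auto

lemma one_nuclear: "\<one> \<in> nuclear"
  unfolding nuclear_def by (auto simp: one_in left_one right_one mult_in)

lemma mult_nuclear:
  assumes a: "a \<in> nuclear" and b: "b \<in> nuclear"
  shows "a \<otimes> b \<in> nuclear"
proof -
  have ab: "a \<in> carrier L" "b \<in> carrier L"
    by (rule nuclearD(1)[OF a], rule nuclearD(1)[OF b])
  show ?thesis
    unfolding nuclear_def
  proof (intro CollectI conjI ballI)
    fix x y assume x: "x \<in> carrier L" and y: "y \<in> carrier L"
    show "(a \<otimes> b \<otimes> x) \<otimes> y = a \<otimes> b \<otimes> (x \<otimes> y)"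
      using ab x y by (simp add: nuclearD(2)[OF a] nuclearD(2)[OF b] mult_in)
    have "(x \<otimes> (a \<otimes> b)) \<otimes> y = ((x \<otimes> a) \<otimes> b) \<otimes> y"
      using ab x by (simp only: nuclearD(4)[OF b])
    also have "\<dots> = x \<otimes> (a \<otimes> (b \<otimes> y))"
      using ab x y nuclearD(3)[OF b, of "x \<otimes> a" y] nuclearD(3)[OF a, of x "b \<otimes> y"]
      by (simp add: mult_in)
    also have "\<dots> = x \<otimes> (a \<otimes> b \<otimes> y)"
      using ab y by (simp only: nuclearD(2)[OF a])
    finally show "(x \<otimes> (a \<otimes> b)) \<otimes> y = x \<otimes> (a \<otimes> b \<otimes> y)" .
    have "(x \<otimes> y) \<otimes> (a \<otimes> b) = ((x \<otimes> y) \<otimes> a) \<otimes> b"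
      using ab x y by (simp only: nuclearD(4)[OF b] mult_in)
    also have "\<dots> = x \<otimes> ((y \<otimes> a) \<otimes> b)"
      using ab x y by (simp only: nuclearD(4)[OF a] nuclearD(4)[OF b] mult_in)
    also have "\<dots> = x \<otimes> (y \<otimes> (a \<otimes> b))"
      using ab y by (simp only: nuclearD(4)[OF b])
    finally show "(x \<otimes> y) \<otimes> (a \<otimes> b) = x \<otimes> (y \<otimes> (a \<otimes> b))" .
  qed (use ab mult_in in blast)
qed

end

section \<open>Inverse properties, nuclei and powers in Moufang loops\<close>

context moufang_loop
begin

text \<open>If x y = 1, the Moufang law reads x z = x(y(x z)), and cancelling x gives the left
  inverse property for x. Applied to y, it produces u with y u = 1 = y x, so u = x and the remaining
  identity follows.\<close>

lemma inverse_ex: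
  assumes x: "x \<in> carrier L"
  obtains y where "y \<in> carrier L" "x \<otimes> y = \<one>" "y \<otimes> x = \<one>"
    "\<And>z. z \<in> carrier L \<Longrightarrow> y \<otimes> (x \<otimes> z) = z" "\<And>z. z \<in> carrier L \<Longrightarrow> x \<otimes> (y \<otimes> z) = z"
proof -
  have lip: "\<exists>y\<in>carrier L. x \<otimes> y = \<one> \<and> y \<otimes> x = \<one> \<and> (\<forall>z\<in>carrier L. y \<otimes> (x \<otimes> z) = z)"
    if x: "x \<in> carrier L" for x
  proof -
    obtain y where y: "y \<in> carrier L" "x \<otimes> y = \<one>"
      using left_division[OF x one_in] by blast
    have *: "y \<otimes> (x \<otimes> z) = z" if z: "z \<in> carrier L" for z
    proof (rule left_cancel[OF x])
      show "x \<otimes> (y \<otimes> (x \<otimes> z)) = x \<otimes> z"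
        using moufang[OF x y(1) z] y x by (simp add: left_one)
    qed (use x y z mult_in in auto)
    moreover have "y \<otimes> x = \<one>"
      using *[OF one_in] x by (simp add: right_one)
    ultimately show ?thesis using y by blast
  qed
  obtain y where y: "y \<in> carrier L" "x \<otimes> y = \<one>" "y \<otimes> x = \<one>" "\<forall>z\<in>carrier L. y \<otimes> (x \<otimes> z) = z"
    using lip[OF x] by blast
  obtain u where u: "u \<in> carrier L" "y \<otimes> u = \<one>" "\<forall>z\<in>carrier L. u \<otimes> (y \<otimes> z) = z"
    using lip[OF y(1)] by blast
  have "u = x"
    using left_cancel[of y u x] x y u by simp
  then show thesis using that y u by blast
qed

lemma
  assumes x: "x \<in> carrier L"
  shows inv_in: "inv x \<in> carrier L" and r_inverse: "x \<otimes> inv x = \<one>" and l_inverse: "inv x \<otimes> x = \<one>"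
    and inv_left: "z \<in> carrier L \<Longrightarrow> inv x \<otimes> (x \<otimes> z) = z"
    and left_inv: "z \<in> carrier L \<Longrightarrow> x \<otimes> (inv x \<otimes> z) = z"
proof -
  obtain y where y: "y \<in> carrier L" "x \<otimes> y = \<one>" "y \<otimes> x = \<one>"
    "\<And>z. z \<in> carrier L \<Longrightarrow> y \<otimes> (x \<otimes> z) = z" "\<And>z. z \<in> carrier L \<Longrightarrow> x \<otimes> (y \<otimes> z) = z"
    using inverse_ex[OF x] by metis
  then have "inv x = y"
    using x by (intro m_inv_eqI)
  then show "inv x \<in> carrier L" "x \<otimes> inv x = \<one>" "inv x \<otimes> x = \<one>"
    "z \<in> carrier L \<Longrightarrow> inv x \<otimes> (x \<otimes> z) = z" "z \<in> carrier L \<Longrightarrow> x \<otimes> (inv x \<otimes> z) = z"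
    using y by auto
qed

lemma inv_inverse: "x \<in> carrier L \<Longrightarrow> inv (inv x) = x"
  by (rule m_inv_eqI) (auto simp: inv_in l_inverse r_inverse)

text \<open>The Moufang law with y replaced by x^-1 u, so that x y becomes an arbitrary u. With z =
  x^-1 it yields the right inverse property.\<close>

lemma moufang_divided:
  assumes "x \<in> carrier L" "u \<in> carrier L" "z \<in> carrier L"
  shows "(u \<otimes> x) \<otimes> z = x \<otimes> ((inv x \<otimes> u) \<otimes> (x \<otimes> z))"
  using moufang[of x "inv x \<otimes> u" z] assms by (simp add: inv_in mult_in left_inv)

lemma mult_inv_right:
  assumes "x \<in> carrier L" "u \<in> carrier L"
  shows "(u \<otimes> x) \<otimes> inv x = u"
  using moufang_divided[of x u "inv x"] assms
  by (simp add: inv_in mult_in left_inv r_inverse right_one)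

lemma inv_mult:
  assumes x: "x \<in> carrier L" and y: "y \<in> carrier L"
  shows "inv (x \<otimes> y) = inv y \<otimes> inv x"
proof -
  have "inv (x \<otimes> y) \<otimes> ((x \<otimes> y) \<otimes> inv y) = inv y"
    using x y by (intro inv_left) (auto simp: mult_in inv_in)
  then have "inv (x \<otimes> y) \<otimes> x = inv y"
    using mult_inv_right[OF y x] by simp
  then show ?thesis
    using mult_inv_right[OF x, of "inv (x \<otimes> y)"] x y by (simp add: inv_in mult_in)
qed

lemma left_nuclear_inv:
  assumes a: "a \<in> carrier L"
    and l: "\<And>x y. \<lbrakk>x \<in> carrier L; y \<in> carrier L\<rbrakk> \<Longrightarrow> (a \<otimes> x) \<otimes> y = a \<otimes> (x \<otimes> y)"
    and "x \<in> carrier L" "y \<in> carrier L"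
  shows "(inv a \<otimes> x) \<otimes> y = inv a \<otimes> (x \<otimes> y)"
proof -
  have "(a \<otimes> (inv a \<otimes> x)) \<otimes> y = a \<otimes> ((inv a \<otimes> x) \<otimes> y)"
    using assms by (intro l) (auto simp: inv_in mult_in)
  then have "inv a \<otimes> (x \<otimes> y) = inv a \<otimes> (a \<otimes> ((inv a \<otimes> x) \<otimes> y))"
    using assms by (simp add: left_inv)
  then show ?thesis
    using assms by (simp add: inv_left inv_in mult_in)
qed

text \<open>The left, middle and right nuclei of a Moufang loop coincide. Middle: (x a) y = a((a^-1
  x)(a y)), and a^-1 is left nuclear too, so the bracket regroups to a(a^-1(x(a y))). Right: left
  nuclearity of a^-1, applied to y^-1 and x^-1, is inverted by \<open>inv_mult\<close>.\<close>

lemma left_nuclear_imp_nuclear: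
  assumes a: "a \<in> carrier L"
    and l: "\<And>x y. \<lbrakk>x \<in> carrier L; y \<in> carrier L\<rbrakk> \<Longrightarrow> (a \<otimes> x) \<otimes> y = a \<otimes> (x \<otimes> y)"
  shows "a \<in> nuclear"
proof -
  have "(x \<otimes> a) \<otimes> y = x \<otimes> (a \<otimes> y)" if "x \<in> carrier L" "y \<in> carrier L" for x y
  proof -
    have "(x \<otimes> a) \<otimes> y = a \<otimes> (inv a \<otimes> (x \<otimes> (a \<otimes> y)))"
      using moufang_divided[of a x y] left_nuclear_inv[OF a l, of x "a \<otimes> y"] that a by (simp add: mult_in)
    then show ?thesis using that a by (simp add: left_inv mult_in)
  qed
  moreover have "(x \<otimes> y) \<otimes> a = x \<otimes> (y \<otimes> a)" if xy: "x \<in> carrier L" "y \<in> carrier L" for x y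
  proof -
    have "(inv a \<otimes> inv y) \<otimes> inv x = inv a \<otimes> (inv y \<otimes> inv x)"
      using left_nuclear_inv[OF a l] xy inv_in by blast
    then have "inv (x \<otimes> (y \<otimes> a)) = inv ((x \<otimes> y) \<otimes> a)"
      using xy a by (simp add: inv_mult mult_in)
    then show ?thesis
      using xy a by (metis inv_inverse mult_in)
  qed
  ultimately show ?thesis
    using a l unfolding nuclear_def by blast
qed

lemma nucleus_eq_nuclear: "nucleus L = nuclear"
proof
  show "nucleus L \<subseteq> nuclear"
    unfolding nucleus_def by (auto intro!: left_nuclear_imp_nuclear simp: associator_eq_one_iff)
  show "nuclear \<subseteq> nucleus L"
    unfolding nucleus_def nuclear_def by (auto simp: associator_eq_one_iff)
qed

lemma inv_nuclear:
  assumes a: "a \<in> nuclear"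
  shows "inv a \<in> nuclear"
  by (rule left_nuclear_imp_nuclear)
    (use left_nuclear_inv[of a] nuclearD(1,2)[OF a] inv_in in auto)

lemma nuclear_group: "group (L\<lparr>carrier := nuclear\<rparr>)"
proof (rule groupI)
  fix x assume "x \<in> carrier (L\<lparr>carrier := nuclear\<rparr>)"
  then show "\<exists>y\<in>carrier (L\<lparr>carrier := nuclear\<rparr>).
      y \<otimes>\<^bsub>L\<lparr>carrier := nuclear\<rparr>\<^esub> x = \<one>\<^bsub>L\<lparr>carrier := nuclear\<rparr>\<^esub>"
    by (auto intro!: bexI[of _ "inv x"] simp: inv_nuclear l_inverse nuclearD(1))
qed (auto simp: one_nuclear mult_nuclear nuclearD left_one)

text \<open>Integer powers depend on the carrier through the description of inverses, so the
  agreement has to be proved before the power laws of the group of nuclear elements can be carried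
  back to the loop.\<close>

lemma int_pow_nuclear_eq:
  assumes a: "a \<in> nuclear"
  shows "a [^]\<^bsub>L\<lparr>carrier := nuclear\<rparr>\<^esub> (k :: int) = a [^] k"
proof -
  interpret N: group "L\<lparr>carrier := nuclear\<rparr>"
    by (rule nuclear_group)
  have nat: "a [^]\<^bsub>L\<lparr>carrier := nuclear\<rparr>\<^esub> (j :: nat) = a [^] j" for j
    by (simp add: nat_pow_def)
  have closed: "a [^] (j :: nat) \<in> nuclear" for j
    using N.nat_pow_closed[of a j] a by (simp add: nat)
  have "inv\<^bsub>L\<lparr>carrier := nuclear\<rparr>\<^esub> b = inv b" if b: "b \<in> nuclear" for b
  proof (rule m_inv_eqI[symmetric])
    show "b \<in> carrier L" "inv\<^bsub>L\<lparr>carrier := nuclear\<rparr>\<^esub> b \<in> carrier L"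
      using N.inv_closed[of b] b by (auto dest: nuclearD(1))
  qed (use N.l_inv[of b] N.r_inv[of b] b in simp_all)
  then show ?thesis
    by (simp add: int_pow_def2 nat closed del: pow_nat)
qed

lemma
  assumes a: "a \<in> nuclear"
  shows int_pow_nuclear: "a [^] (k :: int) \<in> nuclear"
    and int_pow_add: "a [^] (j + k :: int) = a [^] j \<otimes> a [^] k"
    and int_pow_one: "a [^] (1 :: int) = a"
    and int_pow_minus: "a [^] (- k :: int) = inv (a [^] k)"
proof -
  interpret N: group "L\<lparr>carrier := nuclear\<rparr>"
    by (rule nuclear_group)
  show *: "a [^] k \<in> nuclear" for k :: int
    using N.int_pow_closed[of a k] a by (simp add: int_pow_nuclear_eq)
  show add: "a [^] (j + k) = a [^] j \<otimes> a [^] k" for j k :: int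
    using N.int_pow_mult[of a j k] a by (simp add: int_pow_nuclear_eq)
  show "a [^] (1 :: int) = a"
    using N.int_pow_1[of a] a by (simp add: int_pow_nuclear_eq)
  show "a [^] (- k) = inv (a [^] k)"
  proof (rule m_inv_eqI[symmetric])
    show "a [^] k \<in> carrier L" "a [^] (- k) \<in> carrier L"
      using * by (auto dest: nuclearD(1))
  qed (use add[of k "- k"] add[of "- k" k] in simp_all)
qed

end

section \<open>Subloops and quotients\<close>

context loop
begin

text \<open>Cancellation in L forces a quotient taken inside H to be the one taken in L, so unique
  solvability in H amounts to closure under both divisions.\<close>

lemma subloop_iff:
  "subloop H L \<longleftrightarrow> H \<subseteq> carrier L \<and> \<one> \<in> H \<and> (\<forall>a\<in>H. \<forall>b\<in>H. a \<otimes> b \<in> H) \<and>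
     (\<forall>a\<in>H. \<forall>x\<in>carrier L. a \<otimes> x \<in> H \<longrightarrow> x \<in> H) \<and>
     (\<forall>a\<in>H. \<forall>x\<in>carrier L. x \<otimes> a \<in> H \<longrightarrow> x \<in> H)"  (is "_ \<longleftrightarrow> ?closed")
proof
  assume "subloop H L"
  then have H: "H \<subseteq> carrier L" and "loop (L\<lparr>carrier := H\<rparr>)"
    unfolding subloop_def by auto
  then interpret H: loop "L\<lparr>carrier := H\<rparr>" by simp
  have l: "x \<in> H" if "a \<in> H" "x \<in> carrier L" "a \<otimes> x \<in> H" for a x
  proof -
    have "\<exists>!y. y \<in> H \<and> a \<otimes> y = a \<otimes> x"
      using H.left_division[of a "a \<otimes> x"] that by simp
    then obtain y where "y \<in> H" "a \<otimes> y = a \<otimes> x"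
      by blast
    then show ?thesis
      using left_cancel[of a x y] that H by auto
  qed
  have r: "x \<in> H" if "a \<in> H" "x \<in> carrier L" "x \<otimes> a \<in> H" for a x
  proof -
    have "\<exists>!y. y \<in> H \<and> y \<otimes> a = x \<otimes> a"
      using H.right_division[of a "x \<otimes> a"] that by simp
    then obtain y where "y \<in> H" "y \<otimes> a = x \<otimes> a"
      by blast
    then show ?thesis
      using right_cancel[of a x y] that H by auto
  qed
  have one: "\<one> \<in> H" and mult: "\<forall>a\<in>H. \<forall>b\<in>H. a \<otimes> b \<in> H"
    using H.one_in H.mult_in by simp_all
  show ?closed
    by (rule conjI[OF H conjI[OF one conjI[OF mult]]]) (use l r in blast)
next
  assume c: ?closed
  then have H: "H \<subseteq> carrier L" and l: "\<And>a x. \<lbrakk>a \<in> H; x \<in> carrier L; a \<otimes> x \<in> H\<rbrakk> \<Longrightarrow> x \<in> H"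
    and r: "\<And>a x. \<lbrakk>a \<in> H; x \<in> carrier L; x \<otimes> a \<in> H\<rbrakk> \<Longrightarrow> x \<in> H"
    by blast+
  have "\<exists>!x. x \<in> H \<and> a \<otimes> x = b" if ab: "a \<in> H" "b \<in> H" for a b
  proof -
    obtain x where x: "x \<in> carrier L" "a \<otimes> x = b"
      using ex1_implies_ex[OF left_division[of a b]] ab H by auto
    show ?thesis
    proof (rule ex1I[of _ x])
      show "x \<in> H \<and> a \<otimes> x = b"
        using l[OF ab(1) x(1)] x(2) ab(2) by simp
    qed (use x ab H left_cancel[of a] in auto)
  qed
  moreover have "\<exists>!x. x \<in> H \<and> x \<otimes> a = b" if ab: "a \<in> H" "b \<in> H" for a b
  proof -
    obtain x where x: "x \<in> carrier L" "x \<otimes> a = b"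
      using ex1_implies_ex[OF right_division[of a b]] ab H by auto
    show ?thesis
    proof (rule ex1I[of _ x])
      show "x \<in> H \<and> x \<otimes> a = b"
        using r[OF ab(1) x(1)] x(2) ab(2) by simp
    qed (use x ab H right_cancel[of a] in auto)
  qed
  moreover have "\<one> \<in> H" "\<forall>a\<in>H. \<forall>b\<in>H. a \<otimes> b \<in> H"
    using c by blast+
  ultimately have "loop (L\<lparr>carrier := H\<rparr>)"
    using H by unfold_locales (auto simp: left_one right_one subset_iff)
  then show "subloop H L"
    using H unfolding subloop_def by blast
qed

lemma subloopD:
  assumes "subloop H L"
  shows "x \<in> H \<Longrightarrow> x \<in> carrier L"
    and "\<one> \<in> H"
    and "\<lbrakk>x \<in> H; y \<in> H\<rbrakk> \<Longrightarrow> x \<otimes> y \<in> H"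
    and "\<lbrakk>x \<in> H; y \<in> carrier L; x \<otimes> y \<in> H\<rbrakk> \<Longrightarrow> y \<in> H"
    and "\<lbrakk>x \<in> H; y \<in> carrier L; y \<otimes> x \<in> H\<rbrakk> \<Longrightarrow> y \<in> H"
proof -
  note * = assms[unfolded subloop_iff]
  show "x \<in> H \<Longrightarrow> x \<in> carrier L"
    by (rule subsetD[OF conjunct1[OF *]])
  note * = conjunct2[OF *]
  show "\<one> \<in> H"
    by (rule conjunct1[OF *])
  note * = conjunct2[OF *]
  show "\<lbrakk>x \<in> H; y \<in> H\<rbrakk> \<Longrightarrow> x \<otimes> y \<in> H"
    by (rule bspec[OF bspec[OF conjunct1[OF *]]])
  note * = conjunct2[OF *]
  show "\<lbrakk>x \<in> H; y \<in> carrier L; x \<otimes> y \<in> H\<rbrakk> \<Longrightarrow> y \<in> H"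
    by (rule mp[OF bspec[OF bspec[OF conjunct1[OF *]]]])
  show "\<lbrakk>x \<in> H; y \<in> carrier L; y \<otimes> x \<in> H\<rbrakk> \<Longrightarrow> y \<in> H"
    by (rule mp[OF bspec[OF bspec[OF conjunct2[OF *]]]])
qed

lemma subloopI:
  assumes "\<And>x. x \<in> H \<Longrightarrow> x \<in> carrier L"
    and "\<one> \<in> H"
    and "\<And>x y. \<lbrakk>x \<in> H; y \<in> H\<rbrakk> \<Longrightarrow> x \<otimes> y \<in> H"
    and "\<And>x y. \<lbrakk>x \<in> H; y \<in> carrier L; x \<otimes> y \<in> H\<rbrakk> \<Longrightarrow> y \<in> H"
    and "\<And>x y. \<lbrakk>x \<in> H; y \<in> carrier L; y \<otimes> x \<in> H\<rbrakk> \<Longrightarrow> y \<in> H"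
  shows "subloop H L"
  unfolding subloop_iff by (intro conjI subsetI ballI impI) (fact assms)+

lemma subloop_Int:
  assumes H: "subloop H L" and K: "subloop K L"
  shows "subloop (H \<inter> K) L"
proof (rule subloopI)
  note D = subloopD[OF H] subloopD[OF K]
  show "x \<otimes> y \<in> H \<inter> K" if "x \<in> H \<inter> K" "y \<in> H \<inter> K" for x y
    using that D(3,8) by simp
  show "y \<in> H \<inter> K" if "x \<in> H \<inter> K" "y \<in> carrier L" "x \<otimes> y \<in> H \<inter> K" for x y
    using that D(4)[of x y] D(9)[of x y] by simp
  show "y \<in> H \<inter> K" if "x \<in> H \<inter> K" "y \<in> carrier L" "y \<otimes> x \<in> H \<inter> K" for x y
    using that D(5)[of x y] D(10)[of x y] by simp
qed (auto simp: subloopD(1,2)[OF H] subloopD(2)[OF K])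

end

text \<open>The products may differ outside S, so division in L' has to be brought back into S
  first: S is a subloop of L', hence any quotient of two elements of H already lies in S, where the
  products agree.\<close>

lemma subloop_transfer:
  assumes "loop L" "loop L'" and S: "subloop S L" and S': "subloop S L'"
    and one: "\<one>\<^bsub>L\<^esub> = \<one>\<^bsub>L'\<^esub>"
    and agree: "\<And>x y. \<lbrakk>x \<in> S; y \<in> S\<rbrakk> \<Longrightarrow> x \<otimes>\<^bsub>L\<^esub> y = x \<otimes>\<^bsub>L'\<^esub> y"
    and HS: "H \<subseteq> S" and H: "subloop H L"
  shows "subloop H L'"
proof (rule loop.subloopI[OF assms(2)])
  note in_S = subsetD[OF HS]
  note L = loop.subloopD[OF assms(1)] and L' = loop.subloopD[OF assms(2)]
  show "x \<in> carrier L'" if "x \<in> H" for x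
    by (rule L'(1)[OF S' in_S[OF that]])
  show "\<one>\<^bsub>L'\<^esub> \<in> H"
    using L(2)[OF H] by (simp only: one)
  show "x \<otimes>\<^bsub>L'\<^esub> y \<in> H" if x: "x \<in> H" and y: "y \<in> H" for x y
    using L(3)[OF H x y] agree[OF in_S[OF x] in_S[OF y]] by (simp only:)
  show "y \<in> H" if x: "x \<in> H" and y: "y \<in> carrier L'" and xy: "x \<otimes>\<^bsub>L'\<^esub> y \<in> H" for x y
  proof -
    have yS: "y \<in> S"
      by (rule L'(4)[OF S' in_S[OF x] y in_S[OF xy]])
    show ?thesis
      using xy agree[OF in_S[OF x] yS] by (intro L(4)[OF H x L(1)[OF S yS]]) (simp only:)
  qed
  show "y \<in> H" if x: "x \<in> H" and y: "y \<in> carrier L'" and yx: "y \<otimes>\<^bsub>L'\<^esub> x \<in> H" for x y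
  proof -
    have yS: "y \<in> S"
      by (rule L'(5)[OF S' in_S[OF x] y in_S[OF yx]])
    show ?thesis
      using yx agree[OF yS in_S[OF x]] by (intro L(5)[OF H x L(1)[OF S yS]]) (simp only:)
  qed
qed

text \<open>A subloop of L' need not be one of L, but its intersection with S is, and that
  intersection still contains X.\<close>

lemma subloop_generated_mono:
  assumes "loop L" "loop L'" "subloop S L" "subloop S L'" "\<one>\<^bsub>L\<^esub> = \<one>\<^bsub>L'\<^esub>"
    and agree: "\<And>x y. \<lbrakk>x \<in> S; y \<in> S\<rbrakk> \<Longrightarrow> x \<otimes>\<^bsub>L\<^esub> y = x \<otimes>\<^bsub>L'\<^esub> y"
    and "X \<subseteq> S"
  shows "subloop_generated L X \<subseteq> subloop_generated L' X"
proof -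
  have "subloop_generated L X \<subseteq> H" if H: "subloop H L'" "X \<subseteq> H" for H
  proof -
    have "subloop (H \<inter> S) L"
      using assms H loop.subloop_Int[OF assms(2)]
      by (intro subloop_transfer[of L' L S "H \<inter> S"]) auto
    then show ?thesis
      using H assms(7) unfolding subloop_generated_def by blast
  qed
  then show ?thesis
    unfolding subloop_generated_def[of L'] by blast
qed

lemma subloop_generated_cong:
  assumes "loop L" "loop L'" "subloop S L" "subloop S L'" "\<one>\<^bsub>L\<^esub> = \<one>\<^bsub>L'\<^esub>"
    and "\<And>x y. \<lbrakk>x \<in> S; y \<in> S\<rbrakk> \<Longrightarrow> x \<otimes>\<^bsub>L\<^esub> y = x \<otimes>\<^bsub>L'\<^esub> y"
    and "X \<subseteq> S"
  shows "subloop_generated L X = subloop_generated L' X"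
  using assms by (intro equalityI subloop_generated_mono[of _ _ S]) simp_all

section \<open>Cosets of a normal subloop\<close>

context loop
begin

context
  fixes S assumes S: "normal_subloop S L"
begin

lemma normal_subloopD:
  shows "subloop S L" "S \<subseteq> carrier L" "\<one> \<in> S"
    and "x \<in> carrier L \<Longrightarrow> x <# S = S #> x"
    and "\<lbrakk>x \<in> carrier L; y \<in> carrier L\<rbrakk> \<Longrightarrow> x <# (y <# S) = (x \<otimes> y) <# S"
    and "\<lbrakk>x \<in> carrier L; y \<in> carrier L\<rbrakk> \<Longrightarrow> (S #> x) #> y = S #> (x \<otimes> y)"
  using S subloopD(1,2)[of S] unfolding normal_subloop_def by blast+

lemma coset_subset: "x \<in> carrier L \<Longrightarrow> S #> x \<subseteq> carrier L"
  using normal_subloopD(2) by (auto simp: r_coset_def mult_in)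

lemma coset_self: "x \<in> carrier L \<Longrightarrow> x \<in> S #> x"
  using normal_subloopD(3) left_one by (auto simp: r_coset_def intro!: bexI[of _ \<one>])

lemma coset_of_mem:
  assumes s: "s \<in> S"
  shows "S #> s = S"
proof -
  note sub = subloopD(3,5)[OF normal_subloopD(1)]
  have "t \<in> S #> s" if t: "t \<in> S" for t
  proof -
    obtain x where x: "x \<in> carrier L" "x \<otimes> s = t"
      using ex1_implies_ex[OF right_division[of s t]] s t normal_subloopD(2) by auto
    moreover from this have "x \<in> S"
      using sub(2)[OF s, of x] t by simp
    ultimately show ?thesis
      by (auto simp: r_coset_def)
  qed
  then show ?thesis
    using sub(1) s by (auto simp: r_coset_def)
qed

lemma coset_one: "S #> \<one> = S"
  by (rule coset_of_mem) (rule normal_subloopD)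

lemma coset_eq:
  assumes x: "x \<in> carrier L" and y: "y \<in> S #> x"
  shows "S #> y = S #> x"
proof -
  obtain s where "s \<in> S" "y = s \<otimes> x"
    using y by (auto simp: r_coset_def)
  then show ?thesis
    using normal_subloopD(6)[of s x] coset_of_mem[of s] normal_subloopD(2) x by auto
qed

lemma mem_coset_iff:
  "\<lbrakk>x \<in> carrier L; y \<in> carrier L\<rbrakk> \<Longrightarrow> y \<in> S #> x \<longleftrightarrow> S #> y = S #> x"
  using coset_eq coset_self by blast

text \<open>Associativity is replaced by the defining equations of normality: for x' in S x one has
  x'(y S) = (x' y) S = S(x' y) = (S x') y = (S x) y = S(x y).\<close>

lemma coset_mult:
  assumes x: "x \<in> carrier L" and y: "y \<in> carrier L"
  shows "(S #> x) <#> (S #> y) = S #> (x \<otimes> y)"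
proof
  show "(S #> x) <#> (S #> y) \<subseteq> S #> (x \<otimes> y)"
  proof
    fix z assume "z \<in> (S #> x) <#> (S #> y)"
    then obtain x' y' where z: "z = x' \<otimes> y'" and x': "x' \<in> S #> x" and y': "y' \<in> S #> y"
      by (auto simp: set_mult_def)
    have x'_in: "x' \<in> carrier L"
      using coset_subset[OF x] x' by blast
    have "z \<in> x' <# (y <# S)"
      using z y' normal_subloopD(4)[OF y] by (auto simp: l_coset_def)
    also have "\<dots> = (S #> x') #> y"
      using normal_subloopD(4)[of "x' \<otimes> y"] normal_subloopD(5,6)[OF x'_in y] x'_in y
      by (simp only: mult_in)
    also have "\<dots> = S #> (x \<otimes> y)"
      using coset_eq[OF x x'] x y by (simp add: normal_subloopD)
    finally show "z \<in> S #> (x \<otimes> y)" .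
  qed
  have "S #> (x \<otimes> y) = (S #> x) #> y"
    using normal_subloopD(6)[OF x y] by simp
  then show "S #> (x \<otimes> y) \<subseteq> (S #> x) <#> (S #> y)"
    using coset_self[OF y] by (force simp: r_coset_def set_mult_def)
qed

end

end

section \<open>Twisting by a cocycle\<close>

text \<open>The range M has one representative for each residue modulo 2m. Equalities between values
  of \<open>kap\<close> are reduced to congruences by this.\<close>

lemma index_range_unique:
  assumes "a \<in> index_range m" "b \<in> index_range m" "2 * int m dvd a - b"
  shows "a = b"
proof -
  have "\<bar>a - b\<bar> < 2 * int m"
    using assms(1,2) unfolding index_range_def by auto
  then have "a - b = 0"
    using dvd_imp_le_int[OF _ assms(3)] by linarith
  then show ?thesis by simp
qed

text \<open>
  In the application, the coset of \<open>x\<close> is \<open>\<beta>\<^sup>s \<alpha>\<^bsup>kap x\<^esup>\<close> and \<open>eps x = (-1)\<^sup>s\<close>.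
\<close>

locale dihedral_index = moufang_loop G for G (structure) +
  fixes m :: nat and h :: 'a and kap eps :: "'a \<Rightarrow> int"
  assumes m_pos: "m > 0"
    and h_nucleus: "h \<in> nucleus G"
    and eps_cases: "x \<in> carrier G \<Longrightarrow> eps x = 1 \<or> eps x = - 1"
    and eps_mult: "\<lbrakk>x \<in> carrier G; y \<in> carrier G\<rbrakk> \<Longrightarrow> eps (x \<otimes> y) = eps x * eps y"
    and kap_range: "x \<in> carrier G \<Longrightarrow> kap x \<in> index_range m"
    and kap_mult: "\<lbrakk>x \<in> carrier G; y \<in> carrier G\<rbrakk> \<Longrightarrow>
      2 * int m dvd eps y * kap x + kap y - kap (x \<otimes> y)"
    and kap_h: "kap h = 0" and eps_h: "eps h = 1"
    and h_commutes: "\<lbrakk>x \<in> carrier G; eps x = 1\<rbrakk> \<Longrightarrow> h \<otimes> x = x \<otimes> h"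
    and h_inverts: "\<lbrakk>x \<in> carrier G; eps x = - 1\<rbrakk> \<Longrightarrow> (h \<otimes> x) \<otimes> h = x"
begin

lemma h_nuclear: "h \<in> nuclear"
  using h_nucleus by (simp add: nucleus_eq_nuclear)

lemma pow_nuclear: "h [^] (a :: int) \<in> nuclear"
  by (rule int_pow_nuclear[OF h_nuclear])

lemma pow_in [simp]: "h [^] (a :: int) \<in> carrier G"
  by (rule nuclearD(1)[OF pow_nuclear])

lemmas pow_add = int_pow_add[OF h_nuclear]

lemma eps_sq [simp]: "x \<in> carrier G \<Longrightarrow> eps x * eps x = 1"
  using eps_cases[of x] by auto

lemma eps_one [simp]: "eps \<one> = 1"
  using eps_cases[OF one_in] eps_mult[OF one_in one_in] one_in by (auto simp: left_one)

lemma kap_one [simp]: "kap \<one> = 0"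
proof (rule index_range_unique)
  show "0 \<in> index_range m"
    using m_pos by (simp add: index_range_def)
  show "2 * int m dvd kap \<one> - 0"
    using kap_mult[OF one_in one_in] one_in by (simp add: left_one)
qed (simp add: kap_range one_in)

text \<open>In the application this is S.\<close>

definition kernel :: "'a set" where
  "kernel = {x \<in> carrier G. kap x = 0 \<and> eps x = 1}"

lemma kap_mult_kernel:
  assumes "x \<in> carrier G" "s \<in> kernel"
  shows "kap (x \<otimes> s) = kap x"
proof (rule sym, rule index_range_unique)
  show "2 * int m dvd kap x - kap (x \<otimes> s)"
    using kap_mult[of x s] assms by (simp add: kernel_def)
qed (use assms kap_range in \<open>simp_all add: kernel_def mult_in\<close>)

lemma kap_kernel_mult:
  assumes "x \<in> carrier G" "s \<in> kernel"
  shows "kap (s \<otimes> x) = kap x"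
proof (rule sym, rule index_range_unique)
  show "2 * int m dvd kap x - kap (s \<otimes> x)"
    using kap_mult[of s x] assms by (simp add: kernel_def)
qed (use assms kap_range in \<open>simp_all add: kernel_def mult_in\<close>)

lemma kernel_subloop: "subloop kernel G"
proof (rule subloopI)
  show "x \<otimes> y \<in> kernel" if "x \<in> kernel" "y \<in> kernel" for x y
    using that kap_mult_kernel[of x y] by (simp add: kernel_def mult_in eps_mult)
  show "y \<in> kernel" if "x \<in> kernel" "y \<in> carrier G" "x \<otimes> y \<in> kernel" for x y
    using that kap_kernel_mult[of y x] by (simp add: kernel_def eps_mult)
  show "y \<in> kernel" if "x \<in> kernel" "y \<in> carrier G" "y \<otimes> x \<in> kernel" for x y
    using that kap_mult_kernel[of y x] by (simp add: kernel_def eps_mult)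
qed (simp_all add: kernel_def one_in)

lemma h_kernel: "h \<in> kernel"
  using nuclearD(1)[OF h_nuclear] by (simp add: kernel_def kap_h eps_h)

text \<open>Negative powers are reached by right division in H, from h^(i-1) h = h^i.\<close>

lemma pow_in_subloop:
  assumes H: "subloop H G" and h: "h \<in> H"
  shows "h [^] (a :: int) \<in> H"
proof (induction a rule: int_induct[where k = 0])
  case base
  show ?case using subloopD(2)[OF H] by simp
next
  case (step1 i)
  show ?case
    using subloopD(3)[OF H step1.IH h] by (simp add: pow_add int_pow_one[OF h_nuclear])
next
  case (step2 i)
  have "h [^] (i - 1) \<otimes> h = h [^] i"
    using pow_add[of "i - 1" 1] by (simp add: int_pow_one[OF h_nuclear])
  then show ?case
    using subloopD(5)[OF H h, of "h [^] (i - 1)"] step2.IH by simp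
qed

lemma pow_kernel [simp]: "h [^] (a :: int) \<in> kernel"
  by (rule pow_in_subloop[OF kernel_subloop h_kernel])

lemma kap_pow [simp]: "kap (h [^] (a :: int)) = 0" and eps_pow [simp]: "eps (h [^] (a :: int)) = 1"
  using pow_kernel[of a] by (simp_all only: kernel_def mem_Collect_eq)

lemma h_mult:
  assumes x: "x \<in> carrier G"
  shows "h \<otimes> x = x \<otimes> h [^] eps x"
  using eps_cases[OF x]
proof
  assume "eps x = 1"
  then show ?thesis
    using h_commutes[OF x] by (simp add: int_pow_one[OF h_nuclear])
next
  have h: "h \<in> carrier G"
    by (rule nuclearD(1)[OF h_nuclear])
  assume e: "eps x = - 1"
  then have "x \<otimes> inv h = ((h \<otimes> x) \<otimes> h) \<otimes> inv h"
    using h_inverts[OF x] by simp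
  also have "\<dots> = h \<otimes> x"
    using x h by (simp add: mult_inv_right mult_in)
  finally show ?thesis
    using e by (simp add: int_pow_minus[OF h_nuclear] int_pow_one[OF h_nuclear])
qed

text \<open>Induction in both directions from \<open>h_mult\<close>. In the downward step both sides
  are multiplied by h on the left, which brings i - 1 back to i.\<close>

lemma pow_mult:
  assumes x: "x \<in> carrier G"
  shows "h [^] a \<otimes> x = x \<otimes> h [^] (eps x * a)"
proof (induction a rule: int_induct[where k = 0])
  case base
  show ?case using x by (simp add: left_one right_one)
next
  case (step1 i)
  have h: "h \<in> carrier G"
    by (rule nuclearD(1)[OF h_nuclear])
  have "h [^] (i + 1) \<otimes> x = h [^] i \<otimes> (h \<otimes> x)"
    using x h by (simp only: pow_add int_pow_one[OF h_nuclear] nuclearD(2)[OF pow_nuclear])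
  also have "\<dots> = (h [^] i \<otimes> x) \<otimes> h [^] eps x"
    using x by (simp only: h_mult[OF x] nuclearD(4)[OF pow_nuclear] pow_in)
  also have "\<dots> = x \<otimes> h [^] (eps x * i + eps x)"
    using x by (simp only: step1.IH pow_add nuclearD(4)[OF pow_nuclear] pow_in)
  finally show ?case
    by (simp add: algebra_simps)
next
  case (step2 i)
  have h: "h \<in> carrier G"
    by (rule nuclearD(1)[OF h_nuclear])
  show ?case
  proof (rule left_cancel[OF h])
    have "h \<otimes> (h [^] (i - 1) \<otimes> x) = (h \<otimes> h [^] (i - 1)) \<otimes> x"
      using x h by (simp only: nuclearD(2)[OF h_nuclear] pow_in)
    also have "\<dots> = h [^] i \<otimes> x"
      using pow_add[of 1 "i - 1"] by (simp add: int_pow_one[OF h_nuclear])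
    also have "\<dots> = x \<otimes> h [^] (eps x + eps x * (i - 1))"
      using step2.IH by (simp add: algebra_simps)
    also have "\<dots> = (x \<otimes> h [^] eps x) \<otimes> h [^] (eps x * (i - 1))"
      using x by (simp only: pow_add nuclearD(4)[OF pow_nuclear] pow_in)
    also have "\<dots> = h \<otimes> (x \<otimes> h [^] (eps x * (i - 1)))"
      using x h by (simp only: h_mult[OF x, symmetric] nuclearD(2)[OF h_nuclear] pow_in)
    finally show "h \<otimes> (h [^] (i - 1) \<otimes> x) = h \<otimes> (x \<otimes> h [^] (eps x * (i - 1)))" .
  qed (use x in \<open>simp_all add: mult_in\<close>)
qed

text \<open>The normal form of the calculations below. The simplification rules for it collect all
  powers of h on the right, and an exponent that passes an element y is multiplied by
  \<open>eps y\<close>.\<close>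

definition shift :: "'a \<Rightarrow> int \<Rightarrow> 'a" where
  "shift x a = x \<otimes> h [^] a"

lemma shift_in [simp]: "x \<in> carrier G \<Longrightarrow> shift x a \<in> carrier G"
  by (simp add: shift_def mult_in)

lemma shift_zero [simp]: "x \<in> carrier G \<Longrightarrow> shift x 0 = x"
  by (simp add: shift_def right_one)

lemma shift_shift [simp]: "x \<in> carrier G \<Longrightarrow> shift (shift x a) b = shift x (a + b)"
  by (simp only: shift_def pow_add nuclearD(4)[OF pow_nuclear] pow_in)

lemma shift_one: "shift \<one> a = h [^] a"
  by (simp add: shift_def left_one)

lemma kap_shift [simp]: "x \<in> carrier G \<Longrightarrow> kap (shift x a) = kap x"
  by (simp add: shift_def kap_mult_kernel)

lemma eps_shift [simp]: "x \<in> carrier G \<Longrightarrow> eps (shift x a) = eps x"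
  by (simp add: shift_def eps_mult)

lemma mult_shift [simp]:
  assumes x: "x \<in> carrier G" and y: "y \<in> carrier G"
  shows "shift x a \<otimes> shift y b = shift (x \<otimes> y) (eps y * a + b)"
proof -
  have "shift x a \<otimes> shift y b = (x \<otimes> (h [^] a \<otimes> y)) \<otimes> h [^] b"
    using x y by (simp only: shift_def nuclearD(4)[OF pow_nuclear] nuclearD(3)[OF pow_nuclear]
        mult_in pow_in)
  also have "\<dots> = shift (shift (x \<otimes> y) (eps y * a)) b"
    using x y by (simp only: shift_def pow_mult[OF y] nuclearD(4)[OF pow_nuclear] mult_in pow_in)
  finally show ?thesis
    using x y by (simp add: mult_in)
qed

lemma mult_shift_left [simp]:
  assumes "x \<in> carrier G" "y \<in> carrier G"
  shows "shift x a \<otimes> y = shift (x \<otimes> y) (eps y * a)"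
  using mult_shift[OF assms, of a 0] assms by simp

lemma mult_shift_right [simp]:
  assumes "x \<in> carrier G" "y \<in> carrier G"
  shows "x \<otimes> shift y b = shift (x \<otimes> y) b"
  using mult_shift[OF assms, of 0 b] assms by simp

text \<open>Only the powers of h can be compared, not the exponents, since h may have finite
  order.\<close>

lemma shift_cancel:
  assumes x: "x \<in> carrier G" and eq: "shift x a = shift x b"
  shows "h [^] a = h [^] b"
  using left_cancel[OF x _ _ eq[unfolded shift_def]] by simp

text \<open>The division is exact on the carrier by \<open>kap_mult\<close>. The value is the
  exponent given by \<sigma>, as \<open>cocycle_sigma\<close> shows.\<close>

definition cocycle :: "'a \<Rightarrow> 'a \<Rightarrow> int" where
  "cocycle x y = (eps y * kap x + kap y - kap (x \<otimes> y)) div (2 * int m)"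

lemma cocycle_eq:
  assumes "x \<in> carrier G" "y \<in> carrier G"
  shows "2 * int m * cocycle x y = eps y * kap x + kap y - kap (x \<otimes> y)"
  using kap_mult[OF assms] by (simp add: cocycle_def)

lemma cocycle_cancel:
  assumes "2 * int m * a = 2 * int m * b"
  shows "a = b"
  using assms m_pos by simp

lemma cocycle_shift [simp]:
  assumes "x \<in> carrier G" "y \<in> carrier G"
  shows "cocycle (shift x a) y = cocycle x y" "cocycle x (shift y b) = cocycle x y"
  using assms by (simp_all add: cocycle_def mult_in)

lemma cocycle_kernel [simp]:
  assumes "x \<in> carrier G" "s \<in> kernel"
  shows "cocycle x s = 0" "cocycle s x = 0"
  using assms kap_mult_kernel[OF assms] kap_kernel_mult[OF assms]
  by (simp_all add: cocycle_def kernel_def)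

lemma one_kernel [simp]: "\<one> \<in> kernel"
  by (rule subloopD(2)[OF kernel_subloop])

text \<open>Both values are congruent to \<open>eps z * (eps y * kap x + kap y) + kap z\<close>
  modulo 2m. In the application this reflects the associativity of G/S.\<close>

lemma kap_assoc:
  assumes x: "x \<in> carrier G" and y: "y \<in> carrier G" and z: "z \<in> carrier G"
  shows "kap ((x \<otimes> y) \<otimes> z) = kap (x \<otimes> (y \<otimes> z))"
proof (rule index_range_unique)
  have l: "2 * int m dvd (eps z * (eps y * kap x + kap y) + kap z - kap ((x \<otimes> y) \<otimes> z))"
    using dvd_add[OF dvd_mult[OF kap_mult[OF x y], of "eps z"] kap_mult[OF mult_in[OF x y] z]]
    by (simp add: algebra_simps)
  have r: "2 * int m dvd (eps z * (eps y * kap x + kap y) + kap z - kap (x \<otimes> (y \<otimes> z)))"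
    using dvd_add[OF kap_mult[OF y z] kap_mult[OF x mult_in[OF y z]]] y z
    by (simp add: algebra_simps eps_mult)
  show "2 * int m dvd kap ((x \<otimes> y) \<otimes> z) - kap (x \<otimes> (y \<otimes> z))"
    using dvd_diff[OF r l] by simp
qed (use assms in \<open>simp_all add: kap_range mult_in\<close>)

lemma cocycle_assoc:
  assumes x: "x \<in> carrier G" and y: "y \<in> carrier G" and z: "z \<in> carrier G"
  shows "eps z * cocycle x y + cocycle (x \<otimes> y) z = cocycle y z + cocycle x (y \<otimes> z)"
proof (rule cocycle_cancel)
  have "2 * int m * (eps z * cocycle x y + cocycle (x \<otimes> y) z) =
      eps z * (2 * int m * cocycle x y) + 2 * int m * cocycle (x \<otimes> y) z"
    by (simp add: algebra_simps)
  also have "\<dots> = 2 * int m * cocycle y z + 2 * int m * cocycle x (y \<otimes> z)"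
    using assms kap_assoc[OF x y z] by (simp only: cocycle_eq mult_in eps_mult) (simp add: algebra_simps)
  finally show "2 * int m * (eps z * cocycle x y + cocycle (x \<otimes> y) z) =
      2 * int m * (cocycle y z + cocycle x (y \<otimes> z))"
    by (simp add: algebra_simps)
qed

text \<open>After multiplication by 2m the terms \<open>kap\<close> of the intermediate products
  telescope, and the two final products are equal by the Moufang law in G.\<close>

lemma cocycle_moufang:
  assumes x: "x \<in> carrier G" and y: "y \<in> carrier G" and z: "z \<in> carrier G"
  shows "eps (x \<otimes> z) * cocycle x y + eps z * cocycle (x \<otimes> y) x + cocycle ((x \<otimes> y) \<otimes> x) z =
    cocycle x z + cocycle y (x \<otimes> z) + cocycle x (y \<otimes> (x \<otimes> z))"
proof (rule cocycle_cancel)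
  have xx: "eps x * (eps x * t) = t" for t
    using eps_sq[OF x] by (simp flip: mult.assoc)
  have "2 * int m * (eps (x \<otimes> z) * cocycle x y + eps z * cocycle (x \<otimes> y) x +
      cocycle ((x \<otimes> y) \<otimes> x) z) =
    eps (x \<otimes> z) * (2 * int m * cocycle x y) + eps z * (2 * int m * cocycle (x \<otimes> y) x) +
      2 * int m * cocycle ((x \<otimes> y) \<otimes> x) z"
    by (simp add: algebra_simps)
  also have "\<dots> = 2 * int m * cocycle x z + 2 * int m * cocycle y (x \<otimes> z) +
      2 * int m * cocycle x (y \<otimes> (x \<otimes> z))"
    using assms by (simp only: cocycle_eq mult_in eps_mult moufang) (simp add: algebra_simps xx)
  finally show "2 * int m * (eps (x \<otimes> z) * cocycle x y + eps z * cocycle (x \<otimes> y) x +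
      cocycle ((x \<otimes> y) \<otimes> x) z) =
    2 * int m * (cocycle x z + cocycle y (x \<otimes> z) + cocycle x (y \<otimes> (x \<otimes> z)))"
    by (simp add: algebra_simps)
qed

text \<open>As \<open>kap\<close> vanishes on both products, 2m c(x,y) = eps(y) kap(x) + kap(y) and
  2m c(y,x) = eps(x) kap(y) + kap(x); these are related by eps(x) eps(y) = 1. This is the source of
  the extra condition on \<open>\<mu>\<close>.\<close>

lemma cocycle_inverse:
  assumes x: "x \<in> carrier G" and y: "y \<in> carrier G"
    and xy: "x \<otimes> y \<in> kernel" and yx: "y \<otimes> x \<in> kernel"
  shows "cocycle y x = eps x * cocycle x y"
proof (rule cocycle_cancel)
  have *: "kap (x \<otimes> y) = 0" "kap (y \<otimes> x) = 0" "eps x * eps y = 1"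
    using xy yx x y by (auto simp: kernel_def eps_mult)
  have "eps x * (eps y * kap x) = kap x"
    using *(3) by (simp flip: mult.assoc)
  then have "2 * int m * cocycle y x = eps x * (2 * int m * cocycle x y)"
    using x y * by (simp only: cocycle_eq distrib_left right_diff_distrib)
  then show "2 * int m * cocycle y x = 2 * int m * (eps x * cocycle x y)"
    by (simp add: algebra_simps)
qed

text \<open>Neither \<open>eps\<close> nor \<open>kap\<close> distinguishes the two bracketings, so
  the correcting factor must have trivial coordinates.\<close>

lemma associator_kernel:
  assumes x: "x \<in> carrier G" and y: "y \<in> carrier G" and z: "z \<in> carrier G"
  shows "associator G x y z \<in> kernel"
proof -
  let ?w = "associator G x y z" and ?p = "x \<otimes> (y \<otimes> z)"
  note w = associator_ex[OF x y z]
  have p: "?p \<in> carrier G"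
    using assms by (simp add: mult_in)
  have "eps ?p * eps ?w = eps ?p"
    using arg_cong[OF w(2), of eps] w(1) assms by (simp add: eps_mult mult_in)
  then have e: "eps ?w = 1"
    using eps_cases[OF p] by auto
  have "kap ?w = 0"
  proof (rule index_range_unique)
    show "2 * int m dvd kap ?w - 0"
      using kap_mult[OF p w(1)] kap_assoc[OF x y z] w(2) e by simp
  qed (use w m_pos kap_range in \<open>auto simp: index_range_def\<close>)
  with e w(1) show ?thesis by (simp add: kernel_def)
qed

text \<open>The elements x(y s) and (x y) s may differ, but \<open>kap\<close> has the same value on
  them. This absorbs the associator between uv.w and u.vw.\<close>

lemma cocycle_mult_kernel:
  assumes x: "x \<in> carrier G" and y: "y \<in> carrier G" and s: "s \<in> kernel"
  shows "cocycle x (y \<otimes> s) = cocycle x y"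
proof -
  have sG: "s \<in> carrier G" "eps s = 1"
    using s by (simp_all add: kernel_def)
  have "kap (x \<otimes> (y \<otimes> s)) = kap (x \<otimes> y)"
    unfolding kap_assoc[OF x y sG(1), symmetric] using x y s by (simp add: kap_mult_kernel mult_in)
  then show ?thesis
    using x y s sG by (simp add: cocycle_def eps_mult kap_mult_kernel)
qed

end

text \<open>The function \<open>\<eta>s\<close> is a definite description whose value is known only
  on the carrier of the quotient. The factor set property is therefore proved for an explicit
  formula and carried over.\<close>

lemma moufang_factor_set_cong:
  assumes \<eta>: "moufang_factor_set Q A \<phi> \<eta>"
    and eq: "\<And>X Y. \<lbrakk>X \<in> carrier Q; Y \<in> carrier Q\<rbrakk> \<Longrightarrow> \<eta>' X Y = \<eta> X Y"
  shows "moufang_factor_set Q A \<phi> \<eta>'"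
proof -
  interpret Q: moufang_loop Q
    using \<eta> by (simp add: moufang_factor_set_def factor_set_def)
  have "moufang_factor_set Q A \<phi> \<eta>' \<longleftrightarrow> moufang_factor_set Q A \<phi> \<eta>"
    unfolding moufang_factor_set_def factor_set_def
    by (simp only: Pi_iff eq Q.mult_in Q.one_in cong: ball_cong)
  with \<eta> show ?thesis by blast
qed

text \<open>Here u is 1 or -1, so the exponents are merely permuted. This makes left cosets, right
  cosets and the cosets of the twisted product come out as the same sets.\<close>

lemma range_affine:
  fixes f :: "int \<Rightarrow> 'c"
  assumes "u * u = 1"
  shows "range (\<lambda>a. f (u * a + b)) = range f"
proof -
  have "f k \<in> range (\<lambda>a. f (u * a + b))" for k
  proof (rule range_eqI)
    show "f k = f (u * (u * (k - b)) + b)"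
      using assms by (simp flip: mult.assoc)
  qed
  then show ?thesis by blast
qed

declare mult_FactGroup [simp del] one_FactGroup [simp del]

section \<open>The quotient by the powers of h and its factor sets\<close>

context dihedral_index
begin

definition cyc :: "'a set" where
  "cyc = range (\<lambda>a :: int. h [^] a)"

lemma cyc_subset_kernel: "cyc \<subseteq> kernel"
  by (auto simp: cyc_def)

lemma pow_cyc [simp]: "h [^] (a :: int) \<in> cyc"
  by (simp add: cyc_def)

lemma cyc_group: "comm_group (G\<lparr>carrier := cyc\<rparr>)"
proof (rule comm_groupI)
  fix x assume "x \<in> carrier (G\<lparr>carrier := cyc\<rparr>)"
  then obtain a :: int where "x = h [^] a"
    by (auto simp: cyc_def)
  then show "\<exists>y\<in>carrier (G\<lparr>carrier := cyc\<rparr>). y \<otimes>\<^bsub>G\<lparr>carrier := cyc\<rparr>\<^esub> x = \<one>\<^bsub>G\<lparr>carrier := cyc\<rparr>\<^esub>"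
    using pow_add[of "- a" a] by (intro bexI[of _ "h [^] (- a)"]) simp_all
next
  show "\<one>\<^bsub>G\<lparr>carrier := cyc\<rparr>\<^esub> \<in> carrier (G\<lparr>carrier := cyc\<rparr>)"
    using pow_cyc[of 0] by simp
qed (auto simp: cyc_def left_one add_ac simp flip: pow_add)

lemma cyc_subloop: "subloop cyc G"
proof -
  interpret C: comm_group "G\<lparr>carrier := cyc\<rparr>"
    by (rule cyc_group)
  have "loop (G\<lparr>carrier := cyc\<rparr>)"
  proof
    fix a b assume a: "a \<in> carrier (G\<lparr>carrier := cyc\<rparr>)" and b: "b \<in> carrier (G\<lparr>carrier := cyc\<rparr>)"
    show "\<exists>!x. x \<in> carrier (G\<lparr>carrier := cyc\<rparr>) \<and> a \<otimes>\<^bsub>G\<lparr>carrier := cyc\<rparr>\<^esub> x = b"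
      using C.inv_solve_left[OF _ a b] C.inv_closed[OF a] C.m_closed[OF _ b]
      by (intro ex1I[of _ "inv\<^bsub>G\<lparr>carrier := cyc\<rparr>\<^esub> a \<otimes>\<^bsub>G\<lparr>carrier := cyc\<rparr>\<^esub> b"]) metis+
    show "\<exists>!x. x \<in> carrier (G\<lparr>carrier := cyc\<rparr>) \<and> x \<otimes>\<^bsub>G\<lparr>carrier := cyc\<rparr>\<^esub> a = b"
      using C.inv_solve_right[OF _ b a] C.inv_closed[OF a] C.m_closed[OF b]
      by (intro ex1I[of _ "b \<otimes>\<^bsub>G\<lparr>carrier := cyc\<rparr>\<^esub> inv\<^bsub>G\<lparr>carrier := cyc\<rparr>\<^esub> a"]) metis+
  qed (fact C.one_closed C.m_closed C.l_one C.r_one)+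
  then show ?thesis
    by (auto simp: subloop_def cyc_def)
qed

lemma subloop_generated_h: "subloop_generated G {h} = cyc"
proof
  have "h \<in> cyc"
    using pow_cyc[of 1] by (simp add: int_pow_one[OF h_nuclear])
  then show "subloop_generated G {h} \<subseteq> cyc"
    using cyc_subloop by (auto simp: subloop_generated_def)
  show "cyc \<subseteq> subloop_generated G {h}"
    using pow_in_subloop by (auto simp: subloop_generated_def cyc_def)
qed

lemma l_coset_cyc: "x <# cyc = range (shift x)"
  by (auto simp: l_coset_def cyc_def shift_def)

lemma r_coset_cyc:
  assumes "x \<in> carrier G"
  shows "cyc #> x = range (shift x)"
proof -
  have "cyc #> x = range (\<lambda>a. shift x (eps x * a + 0))"
    using assms by (auto simp: r_coset_def cyc_def shift_def pow_mult)
  then show ?thesis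
    using assms by (simp only: range_affine eps_sq)
qed

lemma range_shift_shift:
  assumes "x \<in> carrier G"
  shows "range (shift (shift x a)) = range (shift x)"
proof -
  have "range (shift (shift x a)) = range (\<lambda>b. shift x (1 * b + a))"
    using assms by (auto simp: add.commute)
  then show ?thesis
    by (simp only: range_affine)
qed

lemma coset_shift [simp]: "x \<in> carrier G \<Longrightarrow> shift x a <# cyc = x <# cyc"
  by (simp only: l_coset_cyc range_shift_shift)

lemma coset_eqD:
  assumes "x <# cyc = y <# cyc" "y \<in> carrier G"
  obtains a where "y = shift x a"
proof -
  have "y \<in> range (shift y)"
    using assms(2) by (intro range_eqI[of _ _ 0]) simp
  then show thesis
    using assms(1) that by (auto simp: l_coset_cyc)
qed

lemma coset_memD:
  assumes "y \<in> x <# cyc"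
  obtains a where "y = shift x a"
  using assms by (auto simp: l_coset_cyc)

lemma cyc_normal: "normal_subloop cyc G"
  unfolding normal_subloop_def
proof (intro conjI ballI)
  fix x y assume x: "x \<in> carrier G" and y: "y \<in> carrier G"
  show "x <# cyc = cyc #> x"
    using x by (simp only: l_coset_cyc r_coset_cyc)
  show "x <# (y <# cyc) = (x \<otimes> y) <# cyc"
    using x y by (auto simp: l_coset_def cyc_def nuclearD(4)[OF pow_nuclear])
  have "(cyc #> x) #> y = range (\<lambda>a. shift (x \<otimes> y) (eps y * a + 0))"
    unfolding r_coset_cyc[OF x] using x y by (auto simp: r_coset_def)
  then show "(cyc #> x) #> y = cyc #> (x \<otimes> y)"
    using x y by (simp only: range_affine eps_sq r_coset_cyc mult_in)
qed (rule cyc_subloop)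

lemma quotient_carrier: "carrier (G Mod cyc) = (\<lambda>x. x <# cyc) ` carrier G"
  by (auto simp: FactGroup_def RCOSETS_def l_coset_cyc r_coset_cyc)

lemma quotient_mult:
  assumes "x \<in> carrier G" "y \<in> carrier G"
  shows "(x <# cyc) \<otimes>\<^bsub>G Mod cyc\<^esub> (y <# cyc) = (x \<otimes> y) <# cyc"
  using coset_mult[OF cyc_normal assms] assms normal_subloopD(4)[OF cyc_normal]
  by (simp add: FactGroup_def mult_in)

lemma one_coset: "\<one> <# cyc = cyc"
  unfolding l_coset_cyc by (simp add: shift_one cyc_def)

lemma quotient_one: "\<one>\<^bsub>G Mod cyc\<^esub> = \<one> <# cyc"
  by (simp add: FactGroup_def one_coset)

lemma quotient_cases:
  assumes "X \<in> carrier (G Mod cyc)"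
  obtains x where "x \<in> carrier G" "X = x <# cyc"
  using assms by (auto simp: quotient_carrier)

lemma coset_in [simp]: "x \<in> carrier G \<Longrightarrow> x <# cyc \<in> carrier (G Mod cyc)"
  by (auto simp: quotient_carrier)

text \<open>Quotients are lifted from G. They are unique because two products in the same coset
  differ by a power of h, which can be moved onto the unknown factor before cancelling.\<close>

lemma quotient_moufang: "moufang_loop (G Mod cyc)"
proof
  show "\<one>\<^bsub>G Mod cyc\<^esub> \<in> carrier (G Mod cyc)"
    by (simp add: quotient_one one_in)
  fix X assume "X \<in> carrier (G Mod cyc)"
  then obtain x where x: "x \<in> carrier G" "X = x <# cyc"
    by (rule quotient_cases)
  show "\<one>\<^bsub>G Mod cyc\<^esub> \<otimes>\<^bsub>G Mod cyc\<^esub> X = X" "X \<otimes>\<^bsub>G Mod cyc\<^esub> \<one>\<^bsub>G Mod cyc\<^esub> = X"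
    using x by (simp_all only: quotient_one quotient_mult one_in left_one right_one)
  fix Y assume "Y \<in> carrier (G Mod cyc)"
  then obtain y where y: "y \<in> carrier G" "Y = y <# cyc"
    by (rule quotient_cases)
  show "X \<otimes>\<^bsub>G Mod cyc\<^esub> Y \<in> carrier (G Mod cyc)"
    using x y by (simp only: quotient_mult coset_in mult_in)
  show "\<exists>!Z. Z \<in> carrier (G Mod cyc) \<and> X \<otimes>\<^bsub>G Mod cyc\<^esub> Z = Y"
  proof -
    obtain z where z: "z \<in> carrier G" "x \<otimes> z = y"
      using ex1_implies_ex[OF left_division[OF x(1) y(1)]] by blast
    show ?thesis
    proof (rule ex1I[of _ "z <# cyc"])
      show "z <# cyc \<in> carrier (G Mod cyc) \<and> X \<otimes>\<^bsub>G Mod cyc\<^esub> (z <# cyc) = Y"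
        using x y z by (simp add: quotient_mult)
      fix W assume W: "W \<in> carrier (G Mod cyc) \<and> X \<otimes>\<^bsub>G Mod cyc\<^esub> W = Y"
      then obtain w where w: "w \<in> carrier G" "W = w <# cyc"
        by (auto simp: quotient_carrier)
      then have "(x \<otimes> z) <# cyc = (x \<otimes> w) <# cyc"
        using W x y z by (simp add: quotient_mult)
      then obtain a where "x \<otimes> w = shift (x \<otimes> z) a"
        by (rule coset_eqD) (use x w in \<open>simp add: mult_in\<close>)
      then have "w = shift z a"
        using x w z by - (rule left_cancel[OF x(1)], simp_all)
      then show "W = z <# cyc"
        using w z by simp
    qed
  qed
  show "\<exists>!Z. Z \<in> carrier (G Mod cyc) \<and> Z \<otimes>\<^bsub>G Mod cyc\<^esub> X = Y"
  proof -
    obtain z where z: "z \<in> carrier G" "z \<otimes> x = y"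
      using ex1_implies_ex[OF right_division[OF x(1) y(1)]] by blast
    show ?thesis
    proof (rule ex1I[of _ "z <# cyc"])
      show "z <# cyc \<in> carrier (G Mod cyc) \<and> (z <# cyc) \<otimes>\<^bsub>G Mod cyc\<^esub> X = Y"
        using x y z by (simp add: quotient_mult)
      fix W assume W: "W \<in> carrier (G Mod cyc) \<and> W \<otimes>\<^bsub>G Mod cyc\<^esub> X = Y"
      then obtain w where w: "w \<in> carrier G" "W = w <# cyc"
        by (auto simp: quotient_carrier)
      then have "(z \<otimes> x) <# cyc = (w \<otimes> x) <# cyc"
        using W x y z by (simp add: quotient_mult)
      then obtain a where a: "w \<otimes> x = shift (z \<otimes> x) a"
        by (rule coset_eqD) (use x w in \<open>simp add: mult_in\<close>)
      \<comment> \<open>On this side the power of h has to be moved back through x, so the unknown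
        is shifted by \<open>eps x * a\<close> instead of a.\<close>
      have xx: "eps x * (eps x * a) = a"
        using eps_sq[OF x(1)] by (simp flip: mult.assoc)
      from a have "w = shift z (eps x * a)"
        using x w z by - (rule right_cancel[OF x(1)], simp_all add: xx)
      then show "W = z <# cyc"
        using w z by simp
    qed
  qed
  fix Z assume "Z \<in> carrier (G Mod cyc)"
  then obtain z where z: "z \<in> carrier G" "Z = z <# cyc"
    by (rule quotient_cases)
  show "X \<otimes>\<^bsub>G Mod cyc\<^esub> Y \<otimes>\<^bsub>G Mod cyc\<^esub> X \<otimes>\<^bsub>G Mod cyc\<^esub> Z =
      X \<otimes>\<^bsub>G Mod cyc\<^esub> (Y \<otimes>\<^bsub>G Mod cyc\<^esub> (X \<otimes>\<^bsub>G Mod cyc\<^esub> Z))"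
    using x y z by (simp only: quotient_mult mult_in moufang)
qed

text \<open>Every factor set here has the form h^t with integer t. The conditions are imposed on the
  powers, since t itself may satisfy them only modulo the order of h.\<close>

lemma factor_set_powI:
  assumes action: "\<And>x a. x \<in> carrier G \<Longrightarrow> \<phi> (x <# cyc) (h [^] (a :: int)) = h [^] (eps x * a)"
    and right: "\<And>x. x \<in> carrier G \<Longrightarrow> h [^] (t (x <# cyc) (\<one> <# cyc) :: int) = \<one>"
    and left: "\<And>x. x \<in> carrier G \<Longrightarrow> h [^] (t (\<one> <# cyc) (x <# cyc)) = \<one>"
  shows "factor_set (G Mod cyc) (G\<lparr>carrier := cyc\<rparr>) \<phi> (\<lambda>X Y. h [^] t X Y)"
  unfolding factor_set_def
proof (intro conjI ballI)
  fix X assume "X \<in> carrier (G Mod cyc)"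
  then obtain x where x: "x \<in> carrier G" "X = x <# cyc"
    by (rule quotient_cases)
  note act = action[OF x(1), folded x(2)]
  have xx: "eps x * (eps x * a) = a" for a
    using eps_sq[OF x(1)] by (simp flip: mult.assoc)
  show "\<phi> X \<in> iso (G\<lparr>carrier := cyc\<rparr>) (G\<lparr>carrier := cyc\<rparr>)"
  proof (rule isoI)
    show "\<phi> X \<in> hom (G\<lparr>carrier := cyc\<rparr>) (G\<lparr>carrier := cyc\<rparr>)"
      by (rule homI) (auto simp: cyc_def act distrib_left simp flip: pow_add)
    \<comment> \<open>The action of X is its own inverse, as eps takes only the values 1 and
      -1.\<close>
    show "bij_betw (\<phi> X) (carrier (G\<lparr>carrier := cyc\<rparr>)) (carrier (G\<lparr>carrier := cyc\<rparr>))"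
      by (rule bij_betw_byWitness[of _ "\<phi> X"]) (auto simp: cyc_def act xx)
  qed
  show "h [^] t X \<one>\<^bsub>G Mod cyc\<^esub> = \<one>\<^bsub>G\<lparr>carrier := cyc\<rparr>\<^esub>"
    "h [^] t \<one>\<^bsub>G Mod cyc\<^esub> X = \<one>\<^bsub>G\<lparr>carrier := cyc\<rparr>\<^esub>"
    using x left right by (simp_all add: quotient_one)
  fix Y a assume Y: "Y \<in> carrier (G Mod cyc)" and a: "a \<in> carrier (G\<lparr>carrier := cyc\<rparr>)"
  obtain y where y: "y \<in> carrier G" "Y = y <# cyc"
    using Y by (rule quotient_cases)
  obtain b :: int where "a = h [^] b"
    using a by (auto simp: cyc_def)
  then show "\<phi> (X \<otimes>\<^bsub>G Mod cyc\<^esub> Y) a = \<phi> Y (\<phi> X a)"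
    using x y by (simp add: quotient_mult action eps_mult mult_in mult_ac)
qed (simp_all add: quotient_moufang cyc_group)

text \<open>Here \<open>T\<close> is t read on representatives; its defining premise is discharged
  by reflexivity and keeps the identity in a form that matches the one for
  \<open>cocycle\<close>.\<close>

lemma moufang_factor_set_powI:
  assumes "\<And>x a. x \<in> carrier G \<Longrightarrow> \<phi> (x <# cyc) (h [^] (a :: int)) = h [^] (eps x * a)"
    and "\<And>x. x \<in> carrier G \<Longrightarrow> h [^] (t (x <# cyc) (\<one> <# cyc) :: int) = \<one>"
    and "\<And>x. x \<in> carrier G \<Longrightarrow> h [^] (t (\<one> <# cyc) (x <# cyc)) = \<one>"
    and T: "\<And>x y. T x y = t (x <# cyc) (y <# cyc)"
    and m: "\<And>x y z. \<lbrakk>x \<in> carrier G; y \<in> carrier G; z \<in> carrier G\<rbrakk> \<Longrightarrow>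
      h [^] (eps (x \<otimes> z) * T x y + eps z * T (x \<otimes> y) x + T ((x \<otimes> y) \<otimes> x) z) =
      h [^] (T x z + T y (x \<otimes> z) + T x (y \<otimes> (x \<otimes> z)))"
  shows "moufang_factor_set (G Mod cyc) (G\<lparr>carrier := cyc\<rparr>) \<phi> (\<lambda>X Y. h [^] t X Y)"
  unfolding moufang_factor_set_def
proof (intro conjI ballI)
  fix X Y Z
  assume "X \<in> carrier (G Mod cyc)" "Y \<in> carrier (G Mod cyc)" "Z \<in> carrier (G Mod cyc)"
  then obtain x y z where "x \<in> carrier G" "X = x <# cyc" "y \<in> carrier G" "Y = y <# cyc"
    "z \<in> carrier G" "Z = z <# cyc"
    by (auto simp: quotient_carrier)
  then show "\<phi> (X \<otimes>\<^bsub>G Mod cyc\<^esub> Z) (h [^] t X Y) \<otimes>\<^bsub>G\<lparr>carrier := cyc\<rparr>\<^esub>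
       \<phi> Z (h [^] t (X \<otimes>\<^bsub>G Mod cyc\<^esub> Y) X) \<otimes>\<^bsub>G\<lparr>carrier := cyc\<rparr>\<^esub>
       h [^] t (X \<otimes>\<^bsub>G Mod cyc\<^esub> Y \<otimes>\<^bsub>G Mod cyc\<^esub> X) Z =
       h [^] t X Z \<otimes>\<^bsub>G\<lparr>carrier := cyc\<rparr>\<^esub> h [^] t Y (X \<otimes>\<^bsub>G Mod cyc\<^esub> Z) \<otimes>\<^bsub>G\<lparr>carrier := cyc\<rparr>\<^esub>
       h [^] t X (Y \<otimes>\<^bsub>G Mod cyc\<^esub> (X \<otimes>\<^bsub>G Mod cyc\<^esub> Z))"
    using m[of x y z] assms(1)
    by (simp add: quotient_mult mult_in T flip: pow_add)
qed (rule factor_set_powI; fact assms)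

lemma associative_factor_set_powI:
  assumes "\<And>x a. x \<in> carrier G \<Longrightarrow> \<phi> (x <# cyc) (h [^] (a :: int)) = h [^] (eps x * a)"
    and "\<And>x. x \<in> carrier G \<Longrightarrow> h [^] (t (x <# cyc) (\<one> <# cyc) :: int) = \<one>"
    and "\<And>x. x \<in> carrier G \<Longrightarrow> h [^] (t (\<one> <# cyc) (x <# cyc)) = \<one>"
    and T: "\<And>x y. T x y = t (x <# cyc) (y <# cyc)"
    and m: "\<And>x y z. \<lbrakk>x \<in> carrier G; y \<in> carrier G; z \<in> carrier G\<rbrakk> \<Longrightarrow>
      h [^] (eps z * T x y + T (x \<otimes> y) z) = h [^] (T y z + T x (y \<otimes> z))"
  shows "associative_factor_set (G Mod cyc) (G\<lparr>carrier := cyc\<rparr>) \<phi> (\<lambda>X Y. h [^] t X Y)"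
  unfolding associative_factor_set_def
proof (intro conjI ballI)
  fix X Y Z
  assume "X \<in> carrier (G Mod cyc)" "Y \<in> carrier (G Mod cyc)" "Z \<in> carrier (G Mod cyc)"
  then obtain x y z where "x \<in> carrier G" "X = x <# cyc" "y \<in> carrier G" "Y = y <# cyc"
    "z \<in> carrier G" "Z = z <# cyc"
    by (auto simp: quotient_carrier)
  then show "\<phi> Z (h [^] t X Y) \<otimes>\<^bsub>G\<lparr>carrier := cyc\<rparr>\<^esub> h [^] t (X \<otimes>\<^bsub>G Mod cyc\<^esub> Y) Z =
       h [^] t Y Z \<otimes>\<^bsub>G\<lparr>carrier := cyc\<rparr>\<^esub> h [^] t X (Y \<otimes>\<^bsub>G Mod cyc\<^esub> Z)"
    using m[of x y z] assms(1)
    by (simp add: quotient_mult mult_in T flip: pow_add)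
qed (rule factor_set_powI; fact assms)

text \<open>For the chosen representatives p(x) one has p(x) p(y) = p(xy) h^T(x,y); solving for the
  product is what puts the minus sign on t. Expanding both sides of the Moufang law for p(x), p(y),
  p(z) and cancelling the common representative compares the collected powers of h.\<close>

lemma transversal_exponents:
  assumes transversal: "\<And>x. x \<in> carrier G \<Longrightarrow> \<pi> (x <# cyc) \<in> x <# cyc"
    and \<pi>_one: "\<pi> cyc = \<one>"
    and \<pi>_mult: "\<And>x y. \<lbrakk>x \<in> carrier G; y \<in> carrier G\<rbrakk> \<Longrightarrow>
      \<pi> ((x \<otimes> y) <# cyc) = shift (\<pi> (x <# cyc) \<otimes> \<pi> (y <# cyc)) (- t (x <# cyc) (y <# cyc))"
    and T: "\<And>x y. T x y = t (x <# cyc) (y <# cyc)"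
  shows "x \<in> carrier G \<Longrightarrow> h [^] (T x \<one>) = \<one>"
    and "x \<in> carrier G \<Longrightarrow> h [^] (T \<one> x) = \<one>"
    and "\<lbrakk>x \<in> carrier G; y \<in> carrier G; z \<in> carrier G\<rbrakk> \<Longrightarrow>
      h [^] (eps (x \<otimes> z) * T x y + eps z * T (x \<otimes> y) x + T ((x \<otimes> y) \<otimes> x) z) =
      h [^] (T x z + T y (x \<otimes> z) + T x (y \<otimes> (x \<otimes> z)))"
proof -
  define p where "p x = \<pi> (x <# cyc)" for x
  have p: "p x \<in> carrier G" "eps (p x) = eps x" if x: "x \<in> carrier G" for x
  proof -
    obtain a where "\<pi> (x <# cyc) = shift x a"
      using transversal[OF x] by (rule coset_memD)
    then show "p x \<in> carrier G" "eps (p x) = eps x"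
      using x by (simp_all add: p_def)
  qed
  have p_one: "p \<one> = \<one>"
    using \<pi>_one by (simp add: p_def one_coset)
  have pm: "p x \<otimes> p y = shift (p (x \<otimes> y)) (T x y)" if "x \<in> carrier G" "y \<in> carrier G" for x y
  proof -
    have "p (x \<otimes> y) = shift (p x \<otimes> p y) (- T x y)"
      using \<pi>_mult[OF that] by (simp only: p_def T)
    then have "shift (p (x \<otimes> y)) (T x y) = shift (shift (p x \<otimes> p y) (- T x y)) (T x y)"
      by (rule arg_cong)
    then show ?thesis
      using p(1) that by (simp add: mult_in)
  qed
  {
    assume x: "x \<in> carrier G"
    have "shift (p x) (T x \<one>) = p x \<otimes> p \<one>"
      using pm[OF x one_in] x by (simp only: right_one)
    also have "\<dots> = shift (p x) 0"
      using p(1)[OF x] by (simp add: p_one right_one)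
    finally have r: "shift (p x) (T x \<one>) = shift (p x) 0" .
    have "shift (p x) (T \<one> x) = p \<one> \<otimes> p x"
      using pm[OF one_in x] x by (simp only: left_one)
    also have "\<dots> = shift (p x) 0"
      using p(1)[OF x] by (simp add: p_one left_one)
    finally have l: "shift (p x) (T \<one> x) = shift (p x) 0" .
    show "h [^] (T x \<one>) = \<one>" "h [^] (T \<one> x) = \<one>"
      using shift_cancel[OF p(1)[OF x] r] shift_cancel[OF p(1)[OF x] l] by simp_all
  }
  assume x: "x \<in> carrier G" and y: "y \<in> carrier G" and z: "z \<in> carrier G"
  have "((p x \<otimes> p y) \<otimes> p x) \<otimes> p z =
      shift (p (((x \<otimes> y) \<otimes> x) \<otimes> z)) (eps (x \<otimes> z) * T x y + eps z * T (x \<otimes> y) x + T ((x \<otimes> y) \<otimes> x) z)"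
    using x y z by (simp add: pm p mult_in eps_mult algebra_simps)
  moreover have "p x \<otimes> (p y \<otimes> (p x \<otimes> p z)) =
      shift (p (x \<otimes> (y \<otimes> (x \<otimes> z)))) (T x z + T y (x \<otimes> z) + T x (y \<otimes> (x \<otimes> z)))"
    using x y z by (simp add: pm p mult_in algebra_simps)
  ultimately show "h [^] (eps (x \<otimes> z) * T x y + eps z * T (x \<otimes> y) x + T ((x \<otimes> y) \<otimes> x) z) =
      h [^] (T x z + T y (x \<otimes> z) + T x (y \<otimes> (x \<otimes> z)))"
    using moufang[of "p x" "p y" "p z"] moufang[of x y z] x y z p
    by (intro shift_cancel[of "p (x \<otimes> (y \<otimes> (x \<otimes> z)))"]) (simp_all add: mult_in)
qed

text \<open>The cocycle is constant on cosets of \<open>cyc\<close>, so evaluating it at the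
  representatives chosen by \<open>\<pi>\<close> turns it into a function on the quotient that does
  not depend on \<open>\<pi>\<close>.\<close>

lemma cocycle_transversal:
  assumes transversal: "\<And>x. x \<in> carrier G \<Longrightarrow> \<pi> (x <# cyc) \<in> x <# cyc"
    and x: "x \<in> carrier G" and y: "y \<in> carrier G"
  shows "cocycle (\<pi> (x <# cyc)) (\<pi> (y <# cyc)) = cocycle x y"
proof -
  obtain a b where "\<pi> (x <# cyc) = shift x a" "\<pi> (y <# cyc) = shift y b"
    using coset_memD[OF transversal[OF x]] coset_memD[OF transversal[OF y]] by metis
  then show ?thesis
    using x y by simp
qed

text \<open>With p = u(vw), q a representative of the inverse coset and s the associator, (uv)w = p
  s and s lies in \<open>kernel\<close>. Then c(q, p s) = c(q, p) = eps(p) c(p, q), and eps(p s) =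
  eps(p) is the sign by which the coset of p s acts.\<close>

lemma cocycle_inverse_quotient:
  assumes transversal: "\<And>x. x \<in> carrier G \<Longrightarrow> \<pi> (x <# cyc) \<in> x <# cyc"
    and action: "\<And>x a. x \<in> carrier G \<Longrightarrow> \<phi> (x <# cyc) (h [^] (a :: int)) = h [^] (eps x * a)"
    and \<mu>: "\<mu> = (\<lambda>X Y. h [^] cocycle (\<pi> X) (\<pi> Y))"
    and Q: "Q = G Mod cyc"
    and "U \<in> carrier Q" "V \<in> carrier Q" "W \<in> carrier Q"
  shows "\<mu> (inv\<^bsub>Q\<^esub> (U \<otimes>\<^bsub>Q\<^esub> (V \<otimes>\<^bsub>Q\<^esub> W))) ((U \<otimes>\<^bsub>Q\<^esub> V) \<otimes>\<^bsub>Q\<^esub> W) =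
    \<phi> ((U \<otimes>\<^bsub>Q\<^esub> V) \<otimes>\<^bsub>Q\<^esub> W)
      (\<mu> (U \<otimes>\<^bsub>Q\<^esub> (V \<otimes>\<^bsub>Q\<^esub> W)) (inv\<^bsub>Q\<^esub> (U \<otimes>\<^bsub>Q\<^esub> (V \<otimes>\<^bsub>Q\<^esub> W))))"
proof -
  interpret Q: moufang_loop Q
    unfolding Q by (rule quotient_moufang)
  obtain u v w where uvw: "u \<in> carrier G" "v \<in> carrier G" "w \<in> carrier G"
    and UVW: "U = u <# cyc" "V = v <# cyc" "W = w <# cyc"
    using assms(5-7) unfolding Q quotient_carrier by blast
  define p where "p = u \<otimes> (v \<otimes> w)"
  define s where "s = associator G u v w"
  have p: "p \<in> carrier G"
    using uvw by (simp add: p_def mult_in)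
  have s: "s \<in> kernel"
    unfolding s_def by (rule associator_kernel[OF uvw])
  then have sG: "s \<in> carrier G" "eps s = 1"
    by (simp_all add: kernel_def)
  have P: "U \<otimes>\<^bsub>Q\<^esub> (V \<otimes>\<^bsub>Q\<^esub> W) = p <# cyc" and R: "(U \<otimes>\<^bsub>Q\<^esub> V) \<otimes>\<^bsub>Q\<^esub> W = (p \<otimes> s) <# cyc"
    using associator_ex(2)[OF uvw] unfolding UVW Q p_def s_def
    by (simp_all only: quotient_mult uvw mult_in)
  have PQ: "p <# cyc \<in> carrier Q"
    unfolding Q using p by simp
  obtain q where q: "q \<in> carrier G" "inv\<^bsub>Q\<^esub> (p <# cyc) = q <# cyc"
    using Q.inv_in[OF PQ] unfolding Q by (rule quotient_cases)
  have cyc_kernel: "x \<in> kernel" if x: "x \<in> carrier G" and eq: "x <# cyc = \<one> <# cyc" for x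
  proof -
    obtain a where "x = shift \<one> a"
      using eq[symmetric] x by (rule coset_eqD)
    then show ?thesis
      by (simp add: shift_one)
  qed
  have pq: "p \<otimes> q \<in> kernel" "q \<otimes> p \<in> kernel"
    using Q.r_inverse[OF PQ] Q.l_inverse[OF PQ] p q(1)
    unfolding q(2) unfolding Q quotient_one
    by (auto intro!: cyc_kernel simp: quotient_mult mult_in)
  have ps: "p \<otimes> s \<in> carrier G"
    using p sG by (simp add: mult_in)
  have "\<mu> (q <# cyc) ((p \<otimes> s) <# cyc) = h [^] cocycle q (p \<otimes> s)"
    by (simp only: \<mu> cocycle_transversal[OF transversal q(1) ps])
  also have "\<dots> = h [^] (eps (p \<otimes> s) * cocycle p q)"
    using cocycle_mult_kernel[OF q(1) p s] cocycle_inverse[OF p q(1) pq] sG p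
    by (simp add: eps_mult)
  also have "\<dots> = \<phi> ((p \<otimes> s) <# cyc) (\<mu> (p <# cyc) (q <# cyc))"
    by (simp only: \<mu> cocycle_transversal[OF transversal p q(1)] action[OF ps])
  finally show ?thesis
    by (simp only: P R q(2))
qed

end

section \<open>The loop with the twisted product\<close>

locale dihedral_twist = dihedral_index G m h kap eps for G (structure) and m h kap eps +
  fixes Gs :: "('a, 'c) monoid_scheme"
  assumes twist_carrier: "carrier Gs = carrier G"
    and twist_one: "\<one>\<^bsub>Gs\<^esub> = \<one>"
    and twist_mult: "\<lbrakk>x \<in> carrier G; y \<in> carrier G\<rbrakk> \<Longrightarrow>
      x \<otimes>\<^bsub>Gs\<^esub> y = shift (x \<otimes> y) (cocycle x y)"
begin

text \<open>A quotient z taken in G is corrected by a power of h. The correction is determined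
  because the cocycle does not change when an argument is shifted. The Moufang law picks up the two
  sides of \<open>cocycle_moufang\<close> as exponents.\<close>

lemma twist_moufang: "moufang_loop Gs"
proof
  fix x assume "x \<in> carrier Gs"
  then have x: "x \<in> carrier G"
    by (simp add: twist_carrier)
  show "\<one>\<^bsub>Gs\<^esub> \<otimes>\<^bsub>Gs\<^esub> x = x" "x \<otimes>\<^bsub>Gs\<^esub> \<one>\<^bsub>Gs\<^esub> = x"
    using x by (simp_all add: twist_one twist_mult one_in left_one right_one)
next
  fix x y assume "x \<in> carrier Gs" "y \<in> carrier Gs"
  then show "x \<otimes>\<^bsub>Gs\<^esub> y \<in> carrier Gs"
    by (simp add: twist_carrier twist_mult mult_in)
next
  fix a b assume "a \<in> carrier Gs" "b \<in> carrier Gs"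
  then have a: "a \<in> carrier G" and b: "b \<in> carrier G"
    by (simp_all add: twist_carrier)
  show "\<exists>!x. x \<in> carrier Gs \<and> a \<otimes>\<^bsub>Gs\<^esub> x = b"
  proof -
    obtain z where z: "z \<in> carrier G" "a \<otimes> z = b"
      using ex1_implies_ex[OF left_division[OF a b]] by blast
    show ?thesis
    proof (rule ex1I[of _ "shift z (- cocycle a z)"])
      show "shift z (- cocycle a z) \<in> carrier Gs \<and> a \<otimes>\<^bsub>Gs\<^esub> shift z (- cocycle a z) = b"
        using a b z by (simp add: twist_carrier twist_mult)
      fix x assume "x \<in> carrier Gs \<and> a \<otimes>\<^bsub>Gs\<^esub> x = b"
      then have x: "x \<in> carrier G" and ax: "shift (a \<otimes> x) (cocycle a x) = b"
        using a by (auto simp: twist_carrier twist_mult)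
      have "a \<otimes> x = shift (shift (a \<otimes> x) (cocycle a x)) (- cocycle a x)"
        using a x by (simp add: mult_in)
      also have "\<dots> = a \<otimes> shift z (- cocycle a x)"
        unfolding ax using a z by simp
      finally have xz: "x = shift z (- cocycle a x)"
        using a x z by - (rule left_cancel[OF a], simp_all)
      \<comment> \<open>The equation for x has x on both sides; x is a shift of z, so the cocycle on
        the right can be evaluated at z.\<close>
      have "cocycle a x = cocycle a z"
        using arg_cong[OF xz, of "cocycle a"] a z by simp
      with xz show "x = shift z (- cocycle a z)"
        by simp
    qed
  qed
  show "\<exists>!x. x \<in> carrier Gs \<and> x \<otimes>\<^bsub>Gs\<^esub> a = b"
  proof -
    have aa: "eps a * (eps a * t) = t" for t
      using eps_sq[OF a] by (simp flip: mult.assoc)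
    obtain z where z: "z \<in> carrier G" "z \<otimes> a = b"
      using ex1_implies_ex[OF right_division[OF a b]] by blast
    \<comment> \<open>The factor \<open>eps a\<close> compensates for the passage of the correcting
      power through a.\<close>
    show ?thesis
    proof (rule ex1I[of _ "shift z (- eps a * cocycle z a)"])
      show "shift z (- eps a * cocycle z a) \<in> carrier Gs \<and>
          shift z (- eps a * cocycle z a) \<otimes>\<^bsub>Gs\<^esub> a = b"
        using a b z by (simp add: twist_carrier twist_mult aa)
      fix x assume "x \<in> carrier Gs \<and> x \<otimes>\<^bsub>Gs\<^esub> a = b"
      then have x: "x \<in> carrier G" and xa: "shift (x \<otimes> a) (cocycle x a) = b"
        using a by (auto simp: twist_carrier twist_mult)
      have "x \<otimes> a = shift (shift (x \<otimes> a) (cocycle x a)) (- cocycle x a)"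
        using a x by (simp add: mult_in)
      also have "\<dots> = shift z (- eps a * cocycle x a) \<otimes> a"
        unfolding xa using a z by (simp add: aa)
      finally have xz: "x = shift z (- eps a * cocycle x a)"
        using a x z by - (rule right_cancel[OF a], simp_all)
      have "cocycle x a = cocycle z a"
        using arg_cong[OF xz, of "\<lambda>x. cocycle x a"] a z by simp
      with xz show "x = shift z (- eps a * cocycle z a)"
        by simp
    qed
  qed
next
  fix x y z assume "x \<in> carrier Gs" "y \<in> carrier Gs" "z \<in> carrier Gs"
  then have xyz: "x \<in> carrier G" "y \<in> carrier G" "z \<in> carrier G"
    by (simp_all add: twist_carrier)
  have "x \<otimes>\<^bsub>Gs\<^esub> y \<otimes>\<^bsub>Gs\<^esub> x \<otimes>\<^bsub>Gs\<^esub> z = shift (((x \<otimes> y) \<otimes> x) \<otimes> z)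
      (eps (x \<otimes> z) * cocycle x y + eps z * cocycle (x \<otimes> y) x + cocycle ((x \<otimes> y) \<otimes> x) z)"
    using xyz by (simp add: twist_mult mult_in eps_mult algebra_simps)
  also have "\<dots> = shift (x \<otimes> (y \<otimes> (x \<otimes> z)))
      (cocycle x z + cocycle y (x \<otimes> z) + cocycle x (y \<otimes> (x \<otimes> z)))"
    using xyz by (simp only: moufang cocycle_moufang)
  also have "\<dots> = x \<otimes>\<^bsub>Gs\<^esub> (y \<otimes>\<^bsub>Gs\<^esub> (x \<otimes>\<^bsub>Gs\<^esub> z))"
    using xyz by (simp add: twist_mult mult_in algebra_simps)
  finally show "x \<otimes>\<^bsub>Gs\<^esub> y \<otimes>\<^bsub>Gs\<^esub> x \<otimes>\<^bsub>Gs\<^esub> z = x \<otimes>\<^bsub>Gs\<^esub> (y \<otimes>\<^bsub>Gs\<^esub> (x \<otimes>\<^bsub>Gs\<^esub> z))" .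
qed (simp_all add: twist_carrier twist_one one_in)

interpretation Gs: moufang_loop Gs
  by (rule twist_moufang)

text \<open>The cocycle vanishes when either argument lies in \<open>kernel\<close>.\<close>

lemma twist_mult_kernel:
  assumes "x \<in> carrier G" "s \<in> kernel"
  shows "x \<otimes>\<^bsub>Gs\<^esub> s = x \<otimes> s" "s \<otimes>\<^bsub>Gs\<^esub> x = s \<otimes> x"
  using assms subloopD(1)[OF kernel_subloop assms(2)] by (simp_all add: twist_mult mult_in)

lemma kernel_subloop_twist: "subloop kernel Gs"
proof (rule Gs.subloopI)
  note K = subloopD[OF kernel_subloop]
  show "x \<in> carrier Gs" if "x \<in> kernel" for x
    using K(1)[OF that] by (simp add: twist_carrier)
  show "\<one>\<^bsub>Gs\<^esub> \<in> kernel"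
    by (simp add: twist_one)
  show "x \<otimes>\<^bsub>Gs\<^esub> y \<in> kernel" if "x \<in> kernel" "y \<in> kernel" for x y
    using K(3)[OF that] twist_mult_kernel(1)[OF K(1)[OF that(1)] that(2)] by (simp only:)
  show "y \<in> kernel" if "x \<in> kernel" "y \<in> carrier Gs" "x \<otimes>\<^bsub>Gs\<^esub> y \<in> kernel" for x y
  proof (rule K(4)[OF that(1)])
    show y: "y \<in> carrier G"
      using that(2) by (simp only: twist_carrier)
    show "x \<otimes> y \<in> kernel"
      using that(3) twist_mult_kernel(2)[OF y that(1)] by (simp only:)
  qed
  show "y \<in> kernel" if "x \<in> kernel" "y \<in> carrier Gs" "y \<otimes>\<^bsub>Gs\<^esub> x \<in> kernel" for x y
  proof (rule K(5)[OF that(1)])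
    show y: "y \<in> carrier G"
      using that(2) by (simp only: twist_carrier)
    show "y \<otimes> x \<in> kernel"
      using that(3) twist_mult_kernel(1)[OF y that(1)] by (simp only:)
  qed
qed

text \<open>By \<open>cocycle_assoc\<close> both bracketings acquire the same power of h. It passes
  the old associator w unchanged because eps(w) = 1, and multiplying by w is the same in both
  loops.\<close>

lemma twist_associator:
  assumes x: "x \<in> carrier G" and y: "y \<in> carrier G" and z: "z \<in> carrier G"
  shows "associator Gs x y z = associator G x y z"
proof (rule Gs.associator_unique)
  let ?w = "associator G x y z" and ?p = "x \<otimes> (y \<otimes> z)"
  note w = associator_ex[OF x y z]
  have wK: "?w \<in> kernel"
    by (rule associator_kernel[OF x y z])
  have p: "?p \<in> carrier G"
    using assms by (simp add: mult_in)
  have "(x \<otimes>\<^bsub>Gs\<^esub> y) \<otimes>\<^bsub>Gs\<^esub> z =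
      shift ((x \<otimes> y) \<otimes> z) (eps z * cocycle x y + cocycle (x \<otimes> y) z)"
    using assms by (simp add: twist_mult mult_in)
  also have "\<dots> = shift (?p \<otimes> ?w) (cocycle y z + cocycle x (y \<otimes> z))"
    unfolding cocycle_assoc[OF x y z] w(2)[symmetric] ..
  also have "\<dots> = shift ?p (cocycle y z + cocycle x (y \<otimes> z)) \<otimes> ?w"
    using p w(1) wK by (simp add: kernel_def)
  also have "\<dots> = (x \<otimes>\<^bsub>Gs\<^esub> (y \<otimes>\<^bsub>Gs\<^esub> z)) \<otimes> ?w"
    using assms by (simp add: twist_mult mult_in)
  also have "\<dots> = (x \<otimes>\<^bsub>Gs\<^esub> (y \<otimes>\<^bsub>Gs\<^esub> z)) \<otimes>\<^bsub>Gs\<^esub> ?w"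
    using assms by (intro twist_mult_kernel(1)[symmetric] wK)
      (simp add: twist_mult mult_in)
  finally show "(x \<otimes>\<^bsub>Gs\<^esub> y) \<otimes>\<^bsub>Gs\<^esub> z = (x \<otimes>\<^bsub>Gs\<^esub> (y \<otimes>\<^bsub>Gs\<^esub> z)) \<otimes>\<^bsub>Gs\<^esub> ?w" .
qed (use assms associator_ex(1)[OF assms] in \<open>simp_all only: twist_carrier\<close>)

lemma associators_subset_kernel:
  "{associator G x y z | x y z. x \<in> carrier G \<and> y \<in> carrier G \<and> z \<in> carrier G} \<subseteq> kernel"
  using associator_kernel by auto

text \<open>The generators are the same and lie in \<open>kernel\<close>, a common subloop on which
  the two products agree.\<close>

lemma associator_subloop_twist: "associator_subloop Gs = associator_subloop G"
proof -
  have "{associator Gs x y z | x y z. x \<in> carrier Gs \<and> y \<in> carrier Gs \<and> z \<in> carrier Gs} =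
      {associator G x y z | x y z. x \<in> carrier G \<and> y \<in> carrier G \<and> z \<in> carrier G}"
    unfolding twist_carrier by (intro Collect_cong ex_cong1) (auto simp: twist_associator)
  moreover have "subloop_generated G {associator G x y z | x y z. x \<in> carrier G \<and> y \<in> carrier G \<and> z \<in> carrier G} =
      subloop_generated Gs {associator G x y z | x y z. x \<in> carrier G \<and> y \<in> carrier G \<and> z \<in> carrier G}"
    using subloopD(1)[OF kernel_subloop]
    by (intro subloop_generated_cong[OF loop_axioms Gs.loop_axioms kernel_subloop
          kernel_subloop_twist] associators_subset_kernel)
      (simp_all only: twist_one twist_mult_kernel)
  ultimately show ?thesis
    by (simp only: associator_subloop_def)
qed

lemma associator_subloop_kernel: "associator_subloop G \<subseteq> kernel"
  using associators_subset_kernel kernel_subloop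
  unfolding associator_subloop_def subloop_generated_def by blast

lemma nucleus_twist: "nucleus Gs = nucleus G"
  by (auto simp: nucleus_def twist_carrier twist_one twist_associator)

text \<open>Multiplication by elements of \<open>cyc\<close> is not affected by the twist, so the
  cosets are the same sets; between cosets the twist only contributes a power of h, which the
  quotient does not see.\<close>

lemma cyc_normal_twist: "normal_subloop cyc Gs"
  and quotient_carrier_twist: "carrier (Gs Mod cyc) = carrier (G Mod cyc)"
  and quotient_mult_twist: "\<lbrakk>X \<in> carrier (G Mod cyc); Y \<in> carrier (G Mod cyc)\<rbrakk> \<Longrightarrow>
    X \<otimes>\<^bsub>Gs Mod cyc\<^esub> Y = X \<otimes>\<^bsub>G Mod cyc\<^esub> Y"
proof -
  have lc: "x <#\<^bsub>Gs\<^esub> cyc = range (shift x)" if "x \<in> carrier G" for x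
    using that subsetD[OF cyc_subset_kernel] unfolding l_coset_cyc[symmetric]
    by (simp add: l_coset_def twist_mult_kernel)
  have rc: "cyc #>\<^bsub>Gs\<^esub> x = range (shift x)" if "x \<in> carrier G" for x
    using that subsetD[OF cyc_subset_kernel] unfolding r_coset_cyc[OF that, symmetric]
    by (simp add: r_coset_def twist_mult_kernel)
  have sub: "subloop cyc Gs"
    using subsetD[OF cyc_subset_kernel] subloopD(1)[OF kernel_subloop]
    by (intro subloop_transfer[OF loop_axioms Gs.loop_axioms kernel_subloop
          kernel_subloop_twist _ _ cyc_subset_kernel cyc_subloop])
      (simp_all only: twist_one twist_mult_kernel)
  show normal: "normal_subloop cyc Gs"
    unfolding normal_subloop_def
  proof (intro conjI ballI)
    fix x y assume "x \<in> carrier Gs" "y \<in> carrier Gs"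
    then have x: "x \<in> carrier G" and y: "y \<in> carrier G"
      by (simp_all add: twist_carrier)
    have xy: "x \<otimes>\<^bsub>Gs\<^esub> y \<in> carrier G"
      using x y by (simp add: twist_mult mult_in)
    have range_xy: "range (shift (x \<otimes>\<^bsub>Gs\<^esub> y)) = range (shift (x \<otimes> y))"
      using x y by (simp only: twist_mult mult_in range_shift_shift)
    show "x <#\<^bsub>Gs\<^esub> cyc = cyc #>\<^bsub>Gs\<^esub> x"
      by (simp only: lc[OF x] rc[OF x])
    have "x <#\<^bsub>Gs\<^esub> (y <#\<^bsub>Gs\<^esub> cyc) = range (\<lambda>a. shift (x \<otimes> y) (1 * a + cocycle x y))"
      unfolding lc[OF y] using x y by (auto simp: l_coset_def twist_mult mult_in)
    also have "\<dots> = range (shift (x \<otimes> y))"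
      by (rule range_affine) simp
    finally show "x <#\<^bsub>Gs\<^esub> (y <#\<^bsub>Gs\<^esub> cyc) = (x \<otimes>\<^bsub>Gs\<^esub> y) <#\<^bsub>Gs\<^esub> cyc"
      by (simp only: lc[OF xy] range_xy)
    have "(cyc #>\<^bsub>Gs\<^esub> x) #>\<^bsub>Gs\<^esub> y = range (\<lambda>a. shift (x \<otimes> y) (eps y * a + cocycle x y))"
      unfolding rc[OF x] using x y by (auto simp: r_coset_def twist_mult mult_in)
    also have "\<dots> = range (shift (x \<otimes> y))"
      by (rule range_affine) (simp add: y)
    finally show "(cyc #>\<^bsub>Gs\<^esub> x) #>\<^bsub>Gs\<^esub> y = cyc #>\<^bsub>Gs\<^esub> (x \<otimes>\<^bsub>Gs\<^esub> y)"
      by (simp only: rc[OF xy] range_xy)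
  qed (rule sub)
  show "carrier (Gs Mod cyc) = carrier (G Mod cyc)"
    by (auto simp: FactGroup_def RCOSETS_def twist_carrier rc r_coset_cyc)
  assume "X \<in> carrier (G Mod cyc)" "Y \<in> carrier (G Mod cyc)"
  then obtain x y where xy: "x \<in> carrier G" "X = range (shift x)" "y \<in> carrier G" "Y = range (shift y)"
    by (auto simp: quotient_carrier l_coset_cyc)
  have "X \<otimes>\<^bsub>Gs Mod cyc\<^esub> Y = cyc #>\<^bsub>Gs\<^esub> (x \<otimes>\<^bsub>Gs\<^esub> y)"
    using Gs.coset_mult[OF normal, of x y] xy by (simp add: FactGroup_def rc twist_carrier)
  also have "\<dots> = range (shift (x \<otimes> y))"
    using xy by (simp only: rc twist_mult mult_in shift_in range_shift_shift)
  also have "\<dots> = X \<otimes>\<^bsub>G Mod cyc\<^esub> Y"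
    using quotient_mult[OF xy(1,3)] unfolding xy l_coset_cyc by simp
  finally show "X \<otimes>\<^bsub>Gs Mod cyc\<^esub> Y = X \<otimes>\<^bsub>G Mod cyc\<^esub> Y" .
qed

end

section \<open>The dihedral quotient\<close>

lemma dihedral_group_group:
  assumes "n > 0"
  shows "group (dihedral_group n)"
proof (rule groupI)
  fix x y z :: "int \<times> bool"
  show "x \<otimes>\<^bsub>dihedral_group n\<^esub> y \<otimes>\<^bsub>dihedral_group n\<^esub> z =
      x \<otimes>\<^bsub>dihedral_group n\<^esub> (y \<otimes>\<^bsub>dihedral_group n\<^esub> z)"
    by (cases x; cases y; cases z)
      (auto simp: dihedral_group_def mod_simps algebra_simps)
next
  fix x assume "x \<in> carrier (dihedral_group n)"
  then obtain a s where x: "x = (a, s)" "0 \<le> a" "a < int n"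
    by (auto simp: dihedral_group_def)
  show "\<exists>y\<in>carrier (dihedral_group n). y \<otimes>\<^bsub>dihedral_group n\<^esub> x = \<one>\<^bsub>dihedral_group n\<^esub>"
  proof (rule bexI)
    show "(if s then a else (- a) mod int n, s) \<otimes>\<^bsub>dihedral_group n\<^esub> x = \<one>\<^bsub>dihedral_group n\<^esub>"
      using x by (simp add: dihedral_group_def mod_simps)
    show "(if s then a else (- a) mod int n, s) \<in> carrier (dihedral_group n)"
      using x assms by (simp add: dihedral_group_def)
  qed
qed (use assms in \<open>auto simp: dihedral_group_def\<close>)

lemma card_dihedral_group: "card (carrier (dihedral_group n)) = 2 * n"
  by (simp add: dihedral_group_def card_cartesian_product)

text \<open>The isomorphism with the dihedral group enters only through the group law and the order
  4m. It need not send \<beta> and \<gamma> to the standard generators, so coordinates are built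
  from these two involutions themselves.\<close>

locale dihedral_generators = group D for D (structure) +
  fixes m :: nat and \<beta> \<gamma> :: 'a
  assumes m_pos: "m > 0"
    and card_eq: "card (carrier D) = 4 * m"
    and \<beta>: "involution D \<beta>" and \<gamma>: "involution D \<gamma>"
    and ord_eq: "ord (\<beta> \<otimes> \<gamma>) = 2 * m"
begin

lemma generators [simp]:
  "\<beta> \<in> carrier D" "\<gamma> \<in> carrier D" "\<beta> \<noteq> \<one>" "\<gamma> \<noteq> \<one>" "\<beta> \<otimes> \<beta> = \<one>" "\<gamma> \<otimes> \<gamma> = \<one>"
  using \<beta> \<gamma> by (simp_all add: involution_def)

definition rot :: "int \<Rightarrow> 'a" where
  "rot i = (\<beta> \<otimes> \<gamma>) [^] i"

lemma rot_in [simp]: "rot i \<in> carrier D"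
  by (simp add: rot_def)

lemma rot_0: "rot 0 = \<one>"
  by (simp add: rot_def)

lemma rot_1: "rot 1 = \<beta> \<otimes> \<gamma>"
  by (simp add: rot_def)

lemma rot_add: "rot (i + j) = rot i \<otimes> rot j"
  by (simp add: rot_def int_pow_mult)

lemma rot_eq_iff: "rot i = rot j \<longleftrightarrow> 2 * int m dvd i - j"
  by (simp add: rot_def int_pow_eq ord_eq dvd_diff_commute)

lemma \<beta>_left: "x \<in> carrier D \<Longrightarrow> \<beta> \<otimes> (\<beta> \<otimes> x) = x"
  by (simp flip: m_assoc)

lemma \<gamma>_eq: "\<gamma> = \<beta> \<otimes> rot 1"
  by (simp add: rot_1 \<beta>_left)

text \<open>If \<beta> = \<alpha>^i then \<gamma> = \<alpha>^(i+1). Their squares being trivial, m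
  divides i and i + 1, so m = 1 and \<alpha> has order 2; but one of i and i + 1 is even, which
  makes \<beta> or \<gamma> trivial.\<close>

lemma \<beta>_not_rot: "\<beta> \<noteq> rot i"
proof
  assume b: "\<beta> = rot i"
  have "rot (i + i) = rot 0"
    by (simp only: rot_add rot_0 b[symmetric] generators(5))
  then have i: "int m dvd i"
    by (simp add: rot_eq_iff flip: mult_2)
  have c: "\<gamma> = rot (i + 1)"
    using \<gamma>_eq by (simp only: rot_add b[symmetric])
  have "rot ((i + 1) + (i + 1)) = rot 0"
    by (simp only: rot_add[of "i + 1" "i + 1"] rot_0 c[symmetric] generators(6))
  then have "2 * int m dvd 2 * (i + 1)"
    by (simp only: rot_eq_iff diff_0_right mult_2)
  then have "int m dvd i + 1"
    by (simp only: dvd_mult_cancel_left) simp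
  with i have "int m dvd 1"
    using dvd_diff[of "int m" "i + 1" i] by simp
  then have m: "m = 1" by simp
  have "rot i \<noteq> rot 0" "rot (i + 1) \<noteq> rot 0"
    by (simp_all only: rot_0 b[symmetric] c[symmetric] generators(3,4) not_False_eq_True)
  then show False
    unfolding rot_eq_iff m by simp
qed

text \<open>The inverse of \<alpha> = \<beta>\<gamma> is \<gamma>\<beta>, the conjugate of \<alpha>
  by \<beta>; induction in both directions extends this to all powers.\<close>

lemma rot_\<beta>: "rot i \<otimes> \<beta> = \<beta> \<otimes> rot (- i)"
proof -
  have inv_rot: "inv (rot 1) = \<gamma> \<otimes> \<beta>"
    by (rule inv_equality) (simp_all add: rot_1 m_assoc \<beta>_left)
  have 1: "rot 1 \<otimes> \<beta> = \<beta> \<otimes> rot (- 1)"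
    by (simp add: rot_def int_pow_neg inv_rot[unfolded rot_1] m_assoc \<beta>_left)
  have 2: "rot (- 1) \<otimes> \<beta> = \<beta> \<otimes> rot 1"
    using inv_rot by (simp add: rot_def int_pow_neg m_assoc \<beta>_left)
  show ?thesis
  proof (induction i rule: int_induct[where k = 0])
    case base
    show ?case by (simp add: rot_0)
  next
    case (step1 i)
    have "rot (i + 1) \<otimes> \<beta> = rot i \<otimes> (rot 1 \<otimes> \<beta>)"
      by (simp add: rot_add m_assoc)
    also have "\<dots> = (rot i \<otimes> \<beta>) \<otimes> rot (- 1)"
      unfolding 1 by (simp add: m_assoc)
    also have "\<dots> = \<beta> \<otimes> rot (- i + - 1)"
      unfolding step1.IH rot_add by (simp add: m_assoc)
    finally show ?case by simp
  next
    case (step2 i)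
    have "rot (i + - 1) \<otimes> \<beta> = rot i \<otimes> (rot (- 1) \<otimes> \<beta>)"
      unfolding rot_add by (simp add: m_assoc)
    also have "\<dots> = (rot i \<otimes> \<beta>) \<otimes> rot 1"
      unfolding 2 by (simp add: m_assoc)
    also have "\<dots> = \<beta> \<otimes> rot (- i + 1)"
      unfolding step2.IH rot_add by (simp add: m_assoc)
    finally show ?case by simp
  qed
qed

text \<open>The normal form \<beta>^s \<alpha>^i, with \<beta> on the left to match the left blocks
  of the construction.\<close>

definition elt :: "bool \<times> int \<Rightarrow> 'a" where
  "elt = (\<lambda>(s, i). if s then \<beta> \<otimes> rot i else rot i)"

lemma elt_in [simp]: "elt p \<in> carrier D"
  by (simp add: elt_def split: prod.split)

lemma elt_mult: "elt (s, i) \<otimes> elt (t, j) = elt (s \<noteq> t, (if t then - i else i) + j)"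
proof -
  have "rot i \<otimes> (\<beta> \<otimes> x) = \<beta> \<otimes> (rot (- i) \<otimes> x)" if "x \<in> carrier D" for x
    using arg_cong[OF rot_\<beta>[of i], of "\<lambda>y. y \<otimes> x"] that by (simp add: m_assoc)
  then show ?thesis
    by (simp add: elt_def m_assoc rot_add \<beta>_left)
qed

lemma elt_eq_iff: "elt (s, i) = elt (t, j) \<longleftrightarrow> s = t \<and> 2 * int m dvd i - j"
proof -
  have "\<beta> \<otimes> rot i \<noteq> rot j" for i j
  proof
    assume "\<beta> \<otimes> rot i = rot j"
    then have "\<beta> \<otimes> rot i \<otimes> rot (- i) = rot j \<otimes> rot (- i)"
      by (rule arg_cong)
    then have "\<beta> = rot (j + - i)"
      unfolding rot_add by (simp add: m_assoc rot_0 flip: rot_add)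
    with \<beta>_not_rot show False by blast
  qed
  note this this[THEN not_sym]
  then show ?thesis
    by (auto simp: elt_def rot_eq_iff)
qed

text \<open>Surjectivity is by counting: 2 signs and 2m exponents give 4m distinct elements.\<close>

lemma elt_bij: "bij_betw elt (UNIV \<times> index_range m) (carrier D)"
proof -
  have inj: "inj_on elt (UNIV \<times> index_range m)"
    by (auto simp: inj_on_def elt_eq_iff dest: index_range_unique)
  have "finite (carrier D)"
    using card_eq m_pos card_ge_0_finite by force
  moreover have "card (elt ` (UNIV \<times> index_range m)) = card (carrier D)"
    unfolding card_image[OF inj] card_cartesian_product card_eq by (simp add: index_range_def)
  moreover have "elt ` (UNIV \<times> index_range m) \<subseteq> carrier D"
    using elt_in by blast
  ultimately show ?thesis
    unfolding bij_betw_def using inj card_subset_eq by blast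
qed

end

section \<open>The quotient G/S and the coordinates of its cosets\<close>

context dihedral_condition
begin

lemma coset_in_quotient: "x \<in> carrier G \<Longrightarrow> S #> x \<in> carrier (G Mod S)"
  by (auto simp: FactGroup_def RCOSETS_def)

lemma quotient_coset_cases:
  assumes "X \<in> carrier (G Mod S)"
  obtains x where "x \<in> carrier G" "X = S #> x"
  using assms by (auto simp: FactGroup_def RCOSETS_def)

lemma quotient_coset_mult:
  "\<lbrakk>x \<in> carrier G; y \<in> carrier G\<rbrakk> \<Longrightarrow> (S #> x) \<otimes>\<^bsub>G Mod S\<^esub> (S #> y) = S #> (x \<otimes> y)"
  using coset_mult[OF S_normal] by (simp add: FactGroup_def)

lemma quotient_coset_one: "\<one>\<^bsub>G Mod S\<^esub> = S #> \<one>"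
  using coset_one[OF S_normal] by (simp add: FactGroup_def)

text \<open>The relation \<cong> does not presuppose that either side is a group, so the structure
  is transported from the dihedral group along the inverse bijection g.\<close>

lemma quotient_group: "group (G Mod S)"
proof -
  interpret D: group "dihedral_group (2 * m)"
    using dihedral_group_group m_ge_1 by simp
  obtain f where f: "f \<in> hom (G Mod S) (dihedral_group (2 * m))"
    "bij_betw f (carrier (G Mod S)) (carrier (dihedral_group (2 * m)))"
    using quotient_dihedral by (auto simp: is_iso_def iso_def)
  define g where "g = inv_into (carrier (G Mod S)) f"
  have g: "bij_betw g (carrier (dihedral_group (2 * m))) (carrier (G Mod S))"
    unfolding g_def by (rule bij_betw_inv_into[OF f(2)])
  have g_in: "g x \<in> carrier (G Mod S)" and fg: "f (g x) = x"
    if "x \<in> carrier (dihedral_group (2 * m))" for x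
    using that bij_betwE[OF g] bij_betw_inv_into_right[OF f(2)] by (auto simp: g_def)
  have gf: "g (f X) = X" if "X \<in> carrier (G Mod S)" for X
    using that bij_betw_inv_into_left[OF f(2)] by (auto simp: g_def)
  have closed: "X \<otimes>\<^bsub>G Mod S\<^esub> Y \<in> carrier (G Mod S)"
    if "X \<in> carrier (G Mod S)" "Y \<in> carrier (G Mod S)" for X Y
    using that by (elim quotient_coset_cases) (simp add: quotient_coset_mult coset_in_quotient mult_in)
  have "g \<in> iso (dihedral_group (2 * m)) (G Mod S)"
  proof (rule isoI[OF homI g])
    fix x y assume x: "x \<in> carrier (dihedral_group (2 * m))" and y: "y \<in> carrier (dihedral_group (2 * m))"
    have "f (g x \<otimes>\<^bsub>G Mod S\<^esub> g y) = x \<otimes>\<^bsub>dihedral_group (2 * m)\<^esub> y"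
      using hom_mult[OF f(1) g_in[OF x] g_in[OF y]] fg x y by simp
    then show "g (x \<otimes>\<^bsub>dihedral_group (2 * m)\<^esub> y) = g x \<otimes>\<^bsub>G Mod S\<^esub> g y"
      using gf[OF closed[OF g_in[OF x] g_in[OF y]]] by simp
  qed (rule g_in)
  then have grp: "group ((G Mod S)\<lparr>one := g \<one>\<^bsub>dihedral_group (2 * m)\<^esub>\<rparr>)"
    by (rule D.iso_imp_img_group)
  \<comment> \<open>The transported group has g(1) as its unit. It is identified with the unit of
    the quotient record because the coset of 1 is idempotent, and a group has only one
    idempotent.\<close>
  let ?e = "S #> \<one>"
  have e: "?e \<in> carrier (G Mod S)"
    by (rule coset_in_quotient[OF one_in])
  have fe: "f ?e \<in> carrier (dihedral_group (2 * m))"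
    using f(1) e by (auto simp: hom_def)
  have "f ?e \<otimes>\<^bsub>dihedral_group (2 * m)\<^esub> f ?e = f ?e"
    using hom_mult[OF f(1) e e] by (simp add: quotient_coset_mult one_in left_one)
  then have "f ?e = \<one>\<^bsub>dihedral_group (2 * m)\<^esub>"
    using D.l_cancel_one[OF fe fe] by simp
  then have "g \<one>\<^bsub>dihedral_group (2 * m)\<^esub> = \<one>\<^bsub>G Mod S\<^esub>"
    using gf[OF e] by (simp add: quotient_coset_one)
  then show ?thesis
    using grp by simp
qed

end

sublocale dihedral_condition \<subseteq> quot: dihedral_generators "G Mod S" m \<beta> \<gamma>
proof (intro dihedral_generators.intro dihedral_generators_axioms.intro)
  show "card (carrier (G Mod S)) = 4 * m"
    using iso_same_card[OF quotient_dihedral] by (simp add: card_dihedral_group)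
qed (use m_ge_1 in \<open>simp_all add: quotient_group beta_involution gamma_involution alpha_order\<close>)

context dihedral_condition
begin

definition kap :: "'a \<Rightarrow> int" where
  "kap x = snd (inv_into (UNIV \<times> index_range m) quot.elt (S #> x))"

definition eps :: "'a \<Rightarrow> int" where
  "eps x = (if fst (inv_into (UNIV \<times> index_range m) quot.elt (S #> x)) then - 1 else 1)"

lemma
  assumes x: "x \<in> carrier G"
  shows coset_elt: "S #> x = quot.elt (eps x = - 1, kap x)"
    and kap_in: "kap x \<in> index_range m"
proof -
  let ?p = "inv_into (UNIV \<times> index_range m) quot.elt (S #> x)"
  have "quot.elt ?p = S #> x"
    using bij_betw_inv_into_right[OF quot.elt_bij coset_in_quotient[OF x]] .
  moreover have "?p = (eps x = - 1, kap x)"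
    by (simp add: kap_def eps_def prod_eq_iff)
  ultimately show "S #> x = quot.elt (eps x = - 1, kap x)" by simp
  have "?p \<in> UNIV \<times> index_range m"
    using bij_betwE[OF bij_betw_inv_into[OF quot.elt_bij]] coset_in_quotient[OF x] by blast
  then show "kap x \<in> index_range m"
    by (simp add: kap_def mem_Times_iff)
qed

lemma eps_values: "eps x = 1 \<or> eps x = - 1"
  by (simp add: eps_def)

lemma eps_hom:
  assumes "x \<in> carrier G" "y \<in> carrier G"
  shows "eps (x \<otimes> y) = eps x * eps y"
    and "2 * int m dvd eps y * kap x + kap y - kap (x \<otimes> y)"
proof -
  have "quot.elt ((eps x = - 1) \<noteq> (eps y = - 1), (if eps y = - 1 then - kap x else kap x) + kap y) =
      quot.elt (eps (x \<otimes> y) = - 1, kap (x \<otimes> y))"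
    using quotient_coset_mult[OF assms] assms by (simp add: coset_elt mult_in quot.elt_mult)
  then have *: "((eps x = - 1) \<noteq> (eps y = - 1)) = (eps (x \<otimes> y) = - 1)"
    "2 * int m dvd (if eps y = - 1 then - kap x else kap x) + kap y - kap (x \<otimes> y)"
    unfolding quot.elt_eq_iff by auto
  show "eps (x \<otimes> y) = eps x * eps y"
    using eps_values[of x] eps_values[of y] eps_values[of "x \<otimes> y"] *(1) by auto
  show "2 * int m dvd eps y * kap x + kap y - kap (x \<otimes> y)"
    using eps_values[of y] *(2) by auto
qed

lemma coset_elt_iff:
  assumes "x \<in> carrier G" "i \<in> index_range m"
  shows "S #> x = quot.elt (s, i) \<longleftrightarrow> eps x = (if s then - 1 else 1) \<and> kap x = i"
  unfolding coset_elt[OF assms(1)] quot.elt_eq_iff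
  using assms kap_in[OF assms(1)] index_range_unique[of "kap x" m i] eps_values[of x] by auto

lemma S_coset_iff:
  assumes "s \<in> S"
  shows "kap s = 0" "eps s = 1"
proof -
  have s: "s \<in> carrier G"
    using assms normal_subloopD(2)[OF S_normal] by blast
  have "S #> s = quot.elt (False, 0)"
    using coset_of_mem[OF S_normal assms] quotient_coset_one coset_one[OF S_normal]
    by (simp add: quot.elt_def quot.rot_0)
  moreover have "0 \<in> index_range m"
    using m_ge_1 by (simp add: index_range_def)
  ultimately show "kap s = 0" "eps s = 1"
    using coset_elt_iff[OF s, of 0 False] by auto
qed

lemma mem_quotient_iff:
  assumes "X \<in> carrier (G Mod S)"
  shows "x \<in> X \<longleftrightarrow> x \<in> carrier G \<and> S #> x = X"
proof -
  obtain z where z: "z \<in> carrier G" "X = S #> z"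
    using assms by (rule quotient_coset_cases)
  show ?thesis
    unfolding z(2) using coset_subset[OF S_normal z(1)] mem_coset_iff[OF S_normal z(1), of x]
    by blast
qed

lemma alpha_pow: "(\<beta> \<otimes>\<^bsub>G Mod S\<^esub> \<gamma>) [^]\<^bsub>G Mod S\<^esub> i = quot.elt (False, i)"
  by (simp add: quot.elt_def quot.rot_def)

lemma dih_part_iff:
  shows "x \<in> dih_part G S m (\<beta> \<otimes>\<^bsub>G Mod S\<^esub> \<gamma>) 0 \<longleftrightarrow> x \<in> carrier G \<and> eps x = 1"
    and "x \<in> dih_part G S m (\<beta> \<otimes>\<^bsub>G Mod S\<^esub> \<gamma>) 1 \<longleftrightarrow> x \<in> carrier G \<and> eps x = - 1"
proof -
  have *: "x \<in> (\<Union>i\<in>index_range m. quot.elt (False, i)) \<longleftrightarrow> x \<in> carrier G \<and> eps x = 1"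
    using kap_in[of x] coset_elt_iff[of x _ False]
    by (auto simp: mem_quotient_iff[OF quot.elt_in])
  then show "x \<in> dih_part G S m (\<beta> \<otimes>\<^bsub>G Mod S\<^esub> \<gamma>) 0 \<longleftrightarrow> x \<in> carrier G \<and> eps x = 1"
    by (simp add: dih_part_def alpha_pow)
  show "x \<in> dih_part G S m (\<beta> \<otimes>\<^bsub>G Mod S\<^esub> \<gamma>) 1 \<longleftrightarrow> x \<in> carrier G \<and> eps x = - 1"
    using * eps_values[of x] by (auto simp: dih_part_def alpha_pow)
qed

lemma h_nuclear': "h \<in> nuclear"
  using h_nuclear by (simp add: nucleus_eq_nuclear)

text \<open>The commutator is a description over \<open>G0\<close>, which has not been shown to be a
  loop. The quotient w of h y by y h is therefore taken in G; eps(w) = 1 places it in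
  \<open>G0\<close>, so w is the described element, namely 1.\<close>

lemma h_commutes_part:
  assumes y: "y \<in> carrier G" "eps y = 1"
  shows "h \<otimes> y = y \<otimes> h"
proof -
  let ?G0 = "dih_part G S m (\<beta> \<otimes>\<^bsub>G Mod S\<^esub> \<gamma>) 0"
  have h: "h \<in> carrier G"
    by (rule nuclearD(1)[OF h_nuclear'])
  have "commutator (G\<lparr>carrier := ?G0\<rparr>) h y = \<one>"
    using h_central y by (simp add: loop_center_def dih_part_iff)
  then have the1: "(THE w. w \<in> ?G0 \<and> h \<otimes> y = (y \<otimes> h) \<otimes> w) = \<one>"
    by (simp add: commutator_def)
  obtain w where w: "w \<in> carrier G" "(y \<otimes> h) \<otimes> w = h \<otimes> y"
    using ex1_implies_ex[OF left_division[OF mult_in[OF y(1) h] mult_in[OF h y(1)]]] by blast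
  have "eps w = 1"
    using arg_cong[OF w(2), of eps] w(1) y h S_coset_iff(2)[OF h_in_S] by (simp add: eps_hom mult_in)
  with w have "(THE w. w \<in> ?G0 \<and> h \<otimes> y = (y \<otimes> h) \<otimes> w) = w"
    using left_cancel[OF mult_in[OF y(1) h]]
    by (intro the_equality) (auto simp: dih_part_iff)
  with the1 w show ?thesis
    using y h by (simp add: right_one mult_in)
qed

text \<open>The step from some element to every element of the nontrivial part: y = x g with eps(g)
  = 1, so h commutes with g, and nuclearity of h gives (h(x g))h = (h x)(h g) = ((h x)h)g.\<close>

lemma h_inverts_part:
  assumes y: "y \<in> carrier G" "eps y = - 1"
  shows "(h \<otimes> y) \<otimes> h = y"
proof -
  have h: "h \<in> carrier G"
    by (rule nuclearD(1)[OF h_nuclear'])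
  obtain x where x: "x \<in> carrier G" "eps x = - 1" "(h \<otimes> x) \<otimes> h = x"
    using h_inverted dih_part_iff(2) by blast
  obtain g where g: "g \<in> carrier G" "x \<otimes> g = y"
    using ex1_implies_ex[OF left_division[OF x(1) y(1)]] by blast
  have "eps g = 1"
    using arg_cong[OF g(2), of eps] g(1) x y by (simp add: eps_hom)
  then have hg: "h \<otimes> g = g \<otimes> h"
    using g(1) by (intro h_commutes_part)
  have "(h \<otimes> (x \<otimes> g)) \<otimes> h = ((h \<otimes> x) \<otimes> g) \<otimes> h"
    using x(1) g(1) by (simp only: nuclearD(2)[OF h_nuclear'])
  also have "\<dots> = (h \<otimes> x) \<otimes> (h \<otimes> g)"
    using x(1) g(1) h by (simp only: nuclearD(4)[OF h_nuclear'] mult_in hg)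
  also have "\<dots> = ((h \<otimes> x) \<otimes> h) \<otimes> g"
    using x(1) g(1) h by (simp only: nuclearD(3)[OF h_nuclear'] mult_in)
  finally show ?thesis
    using x(3) g(2) by simp
qed

end

sublocale dihedral_condition \<subseteq> ix: dihedral_index G m h kap eps
proof
qed (use m_ge_1 h_nuclear eps_values eps_hom kap_in S_coset_iff[OF h_in_S] h_commutes_part
    h_inverts_part in auto)

section \<open>Blocks, exponents and the values of the definite descriptions\<close>

context dihedral_condition
begin

text \<open>Modulo S, e times \<alpha>^i is \<beta>\<alpha>^i, so both halves of the block have the
  same coordinate \<open>kap\<close> and differ in sign.\<close>

lemma left_block_iff:
  assumes e: "e \<in> \<beta>" and i: "i \<in> index_range m"
  shows "x \<in> left_block G S (\<beta> \<otimes>\<^bsub>G Mod S\<^esub> \<gamma>) e i \<longleftrightarrow> x \<in> carrier G \<and> kap x = i"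
proof -
  have eG: "e \<in> carrier G" "S #> e = \<beta>"
    using e mem_quotient_iff[OF quot.generators(1)] by auto
  obtain z where z: "z \<in> carrier G" "quot.elt (False, i) = S #> z"
    using quot.elt_in by (rule quotient_coset_cases)
  have "e <# (S #> z) = S #> (e \<otimes> z)"
    using normal_subloopD(4,5)[OF S_normal] eG z mult_in by metis
  also have "\<dots> = \<beta> \<otimes>\<^bsub>G Mod S\<^esub> quot.elt (False, i)"
    using eG z quotient_coset_mult[of e z] by simp
  also have "\<dots> = quot.elt (True, i)"
    by (simp add: quot.elt_def)
  finally have *: "e <# quot.elt (False, i) = quot.elt (True, i)"
    by (simp only: z(2))
  show ?thesis
  proof (cases "x \<in> carrier G")
    case True
    then show ?thesis
      unfolding left_block_def alpha_pow * Un_iff mem_quotient_iff[OF quot.elt_in]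
        coset_elt_iff[OF True i]
      using eps_values[of x] by auto
  qed (simp add: left_block_def alpha_pow * mem_quotient_iff)
qed

text \<open>Since \<gamma> = \<beta>\<alpha>, one has \<alpha>^j \<gamma> = \<beta>\<alpha>^(1-j);
  this is the origin of \<open>1 - kap x\<close>.\<close>

lemma right_block_iff:
  assumes f: "f \<in> \<gamma>" and j: "j \<in> index_range m"
  shows "x \<in> right_block G S (\<beta> \<otimes>\<^bsub>G Mod S\<^esub> \<gamma>) f j \<longleftrightarrow>
    x \<in> carrier G \<and> (if eps x = 1 then kap x else 1 - kap x) = j"
proof -
  have fG: "f \<in> carrier G" "S #> f = \<gamma>"
    using f mem_quotient_iff[OF quot.generators(2)] by auto
  obtain z where z: "z \<in> carrier G" "quot.elt (False, j) = S #> z"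
    using quot.elt_in by (rule quotient_coset_cases)
  have \<gamma>: "quot.elt (True, 1) = \<gamma>"
    using quot.\<gamma>_eq by (simp add: quot.elt_def)
  have "(S #> z) #> f = S #> (z \<otimes> f)"
    by (rule normal_subloopD(6)[OF S_normal z(1) fG(1)])
  also have "\<dots> = quot.elt (False, j) \<otimes>\<^bsub>G Mod S\<^esub> \<gamma>"
    using fG z quotient_coset_mult[of z f] by simp
  also have "\<dots> = quot.elt (True, 1 - j)"
    using quot.elt_mult[of False j True 1] \<gamma> by simp
  finally have *: "quot.elt (False, j) #> f = quot.elt (True, 1 - j)"
    by (simp only: z(2))
  \<comment> \<open>The asymmetric range from 1 - m to m is exactly what makes j -> 1 - j preserve
    it.\<close>
  have "1 - j \<in> index_range m"
    using j by (auto simp: index_range_def)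
  note j' = this
  show ?thesis
  proof (cases "x \<in> carrier G")
    case True
    then show ?thesis
      unfolding right_block_def alpha_pow * Un_iff mem_quotient_iff[OF quot.elt_in]
        coset_elt_iff[OF True j] coset_elt_iff[OF True j']
      using eps_values[of x] by auto
  qed (simp add: right_block_def alpha_pow * mem_quotient_iff)
qed

lemma dih_part_iff':
  assumes "r \<in> {0, 1}"
  shows "x \<in> dih_part G S m (\<beta> \<otimes>\<^bsub>G Mod S\<^esub> \<gamma>) r \<longleftrightarrow> x \<in> carrier G \<and> eps x = (- 1) ^ r"
  using assms dih_part_iff by auto

lemma dih_index_iff:
  assumes "e \<in> \<beta>" "f \<in> \<gamma>" and x: "x \<in> carrier G" and y: "y \<in> carrier G"
  shows "dih_index G S m (\<beta> \<otimes>\<^bsub>G Mod S\<^esub> \<gamma>) e f x y i j r \<longleftrightarrow>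
    i = kap x \<and> j = (if eps y = 1 then kap y else 1 - kap y) \<and> r = (if eps y = 1 then 0 else 1)"
proof -
  have j: "(if eps y = 1 then kap y else 1 - kap y) \<in> index_range m"
    using kap_in[OF y] by (auto simp: index_range_def)
  show ?thesis
    unfolding dih_index_def
    using kap_in[OF x] j assms left_block_iff[OF assms(1)] right_block_iff[OF assms(2)]
      eps_values[of y] dih_part_iff'[of r y]
    by (auto simp del: split_paired_All split: if_splits)
qed

text \<open>For i, j in M the number i + j - 2m \<sigma>(i + j) lies in M again. Hence the numerator
  of the cocycle differs from 2m times the claimed value by a difference of two elements of M, which
  is less than 2m in absolute value; being divisible by 2m, it is 0.\<close>

lemma cocycle_sigma:
  assumes x: "x \<in> carrier G" and y: "y \<in> carrier G"
  shows "ix.cocycle x y =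
    (- 1) ^ (if eps y = 1 then 0 else 1 :: nat) *
      dih_sigma m (kap x + (if eps y = 1 then kap y else 1 - kap y))"
proof -
  note range = kap_in[OF x] kap_in[OF y] kap_in[OF mult_in[OF x y]]
  have zero: "t = 0" if "\<bar>2 * int m * t\<bar> < 2 * int m" for t
    using that dvd_imp_le_int[of "2 * int m * t" "2 * int m"] m_ge_1 by fastforce
  have close: "a = b" if "2 * int m * a = d" "\<bar>d - 2 * int m * b\<bar> < 2 * int m" for a b d
    using zero[of "a - b"] that by (simp add: right_diff_distrib)
  show ?thesis
    using eps_values[of y]
  proof
    assume "eps y = 1"
    then show ?thesis
      using range close[OF ix.cocycle_eq[OF x y]]
      by (auto simp: dih_sigma_def index_range_def)
  next
    assume "eps y = - 1"
    then show ?thesis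
      using range close[OF ix.cocycle_eq[OF x y]]
      by (auto simp: dih_sigma_def index_range_def)
  qed
qed

lemma dih_mult_eq:
  assumes "e \<in> \<beta>" "f \<in> \<gamma>" "x \<in> carrier G" "y \<in> carrier G"
  shows "dih_mult G S m (\<beta> \<otimes>\<^bsub>G Mod S\<^esub> \<gamma>) e f h x y = ix.shift (x \<otimes> y) (ix.cocycle x y)"
  unfolding dih_mult_def dih_index_iff[OF assms]
  by (rule the_equality) (simp_all add: ix.shift_def cocycle_sigma[OF assms(3,4)])

end

context dihedral_condition
begin

text \<open>Representatives of one coset of \<open>cyc\<close> have the same eps, so all admissible
  cases agree on the value; x itself supplies an admissible case and makes the value unique.\<close>

lemma dih_action_eq:
  assumes x: "x \<in> carrier G"
  shows "dih_action G S m (\<beta> \<otimes>\<^bsub>G Mod S\<^esub> \<gamma>) ix.cyc (x <# ix.cyc) (h [^] (a :: int)) = h [^] (eps x * a)"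
  unfolding dih_action_def
proof (rule the_equality)
  have sign: "(h [^] a) [^] (eps y :: int) = h [^] (eps y * a)" for y
    using eps_values[of y] int_pow_one[OF ix.pow_nuclear] int_pow_minus[OF ix.pow_nuclear, of a 1]
      int_pow_minus[OF ix.h_nuclear, of a] by auto
  show "\<forall>y\<in>carrier G. \<forall>r\<in>{0, 1}. x <# ix.cyc = y <# ix.cyc \<and>
      y \<in> dih_part G S m (\<beta> \<otimes>\<^bsub>G Mod S\<^esub> \<gamma>) r \<longrightarrow> h [^] (eps x * a) = (h [^] a) [^] ((- 1) ^ r :: int)"
  proof (intro ballI impI, elim conjE)
    fix y and r :: nat
    assume y: "y \<in> carrier G" and r: "r \<in> {0, 1}" and xy: "x <# ix.cyc = y <# ix.cyc"
      and part: "y \<in> dih_part G S m (\<beta> \<otimes>\<^bsub>G Mod S\<^esub> \<gamma>) r"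
    obtain b where "y = ix.shift x b"
      using xy y by (rule ix.coset_eqD)
    then have "eps x = eps y"
      using x by simp
    moreover have "eps y = (- 1) ^ r"
      using part dih_part_iff'[OF r] by blast
    ultimately show "h [^] (eps x * a) = (h [^] a) [^] ((- 1) ^ r :: int)"
      using sign[of y] by simp
  qed
  fix b assume b: "\<forall>y\<in>carrier G. \<forall>r\<in>{0, 1}. x <# ix.cyc = y <# ix.cyc \<and>
      y \<in> dih_part G S m (\<beta> \<otimes>\<^bsub>G Mod S\<^esub> \<gamma>) r \<longrightarrow> b = (h [^] a) [^] ((- 1) ^ r :: int)"
  obtain r :: nat where r: "r \<in> {0, 1}" "eps x = (- 1) ^ r"
    using eps_values[of x] that[of 0] that[of 1] by auto
  then have "b = (h [^] a) [^] ((- 1) ^ r :: int)"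
    using b x dih_part_iff'[OF r(1), of x] by blast
  then show "b = h [^] (eps x * a)"
    using sign[of x] r(2) by simp
qed

text \<open>Independence of the representatives is the invariance of the cocycle under shifts;
  uniqueness again comes from x and y themselves.\<close>

lemma dih_eta_star_eq:
  assumes ef: "e \<in> \<beta>" "f \<in> \<gamma>" and x: "x \<in> carrier G" and y: "y \<in> carrier G"
  shows "dih_eta_star G S m (\<beta> \<otimes>\<^bsub>G Mod S\<^esub> \<gamma>) e f h ix.cyc \<eta> (x <# ix.cyc) (y <# ix.cyc) =
    \<eta> (x <# ix.cyc) (y <# ix.cyc) \<otimes> h [^] ix.cocycle x y"
  unfolding dih_eta_star_def
proof (rule the_equality)
  have exponent: "(- 1) ^ r * dih_sigma m (i + j) = ix.cocycle u v"
    if "u \<in> carrier G" "v \<in> carrier G" "dih_index G S m (\<beta> \<otimes>\<^bsub>G Mod S\<^esub> \<gamma>) e f u v i j r"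
    for u v i j r
    using that(3) unfolding dih_index_iff[OF ef that(1,2)] cocycle_sigma[OF that(1,2)] by simp
  show "\<forall>u\<in>carrier G. \<forall>v\<in>carrier G. \<forall>i j r.
      x <# ix.cyc = u <# ix.cyc \<and> y <# ix.cyc = v <# ix.cyc \<and>
      dih_index G S m (\<beta> \<otimes>\<^bsub>G Mod S\<^esub> \<gamma>) e f u v i j r \<longrightarrow>
      \<eta> (x <# ix.cyc) (y <# ix.cyc) \<otimes> h [^] ix.cocycle x y =
      \<eta> (x <# ix.cyc) (y <# ix.cyc) \<otimes> h [^] ((- 1) ^ r * dih_sigma m (i + j))"
  proof (intro ballI allI impI, elim conjE)
    fix u v i j r
    assume u: "u \<in> carrier G" and v: "v \<in> carrier G"
      and xu: "x <# ix.cyc = u <# ix.cyc" and yv: "y <# ix.cyc = v <# ix.cyc"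
      and index: "dih_index G S m (\<beta> \<otimes>\<^bsub>G Mod S\<^esub> \<gamma>) e f u v i j r"
    obtain a where "u = ix.shift x a"
      using xu u by (rule ix.coset_eqD)
    moreover obtain b where "v = ix.shift y b"
      using yv v by (rule ix.coset_eqD)
    ultimately have "ix.cocycle x y = ix.cocycle u v"
      using x y by simp
    then show "\<eta> (x <# ix.cyc) (y <# ix.cyc) \<otimes> h [^] ix.cocycle x y =
        \<eta> (x <# ix.cyc) (y <# ix.cyc) \<otimes> h [^] ((- 1) ^ r * dih_sigma m (i + j))"
      by (simp only: exponent[OF u v index])
  qed
  fix b assume b: "\<forall>u\<in>carrier G. \<forall>v\<in>carrier G. \<forall>i j r.
      x <# ix.cyc = u <# ix.cyc \<and> y <# ix.cyc = v <# ix.cyc \<and>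
      dih_index G S m (\<beta> \<otimes>\<^bsub>G Mod S\<^esub> \<gamma>) e f u v i j r \<longrightarrow>
      b = \<eta> (x <# ix.cyc) (y <# ix.cyc) \<otimes> h [^] ((- 1) ^ r * dih_sigma m (i + j))"
  obtain i j r where index: "dih_index G S m (\<beta> \<otimes>\<^bsub>G Mod S\<^esub> \<gamma>) e f x y i j r"
    using dih_index_iff[OF ef x y] by blast
  then have "b = \<eta> (x <# ix.cyc) (y <# ix.cyc) \<otimes> h [^] ((- 1) ^ r * dih_sigma m (i + j))"
    using b x y by blast
  then show "b = \<eta> (x <# ix.cyc) (y <# ix.cyc) \<otimes> h [^] ix.cocycle x y"
    by (simp only: exponent[OF x y index])
qed

end

section \<open>The factor sets of both loops and the conclusions\<close>

theorem theorem7p3: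
  fixes G :: "('a, 'b) monoid_scheme" (structure)
    and Gs :: "('a, 'b) monoid_scheme"
    and S \<alpha> \<beta> \<gamma> A :: "'a set" and m :: nat and h e f :: 'a
    and Q :: "'a set monoid"
    and \<phi> :: "'a set \<Rightarrow> 'a \<Rightarrow> 'a"
    and \<pi> :: "'a set \<Rightarrow> 'a"
    and \<tau> :: "'a set \<Rightarrow> 'a set \<Rightarrow> int"
    and \<eta> \<eta>s :: "'a set \<Rightarrow> 'a set \<Rightarrow> 'a"
  assumes D: "dihedral_condition G S m \<beta> \<gamma> h"
    and \<alpha>: "\<alpha> = \<beta> \<otimes>\<^bsub>G Mod S\<^esub> \<gamma>"
    and e: "e \<in> \<beta>" and f: "f \<in> \<gamma>"
    and Gs: "Gs = dihedral_construction G S m \<alpha> e f h"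
    and A: "A = subloop_generated G {h}"
    and Q: "Q = G Mod A"
    and \<phi>: "\<phi> = dih_action G S m \<alpha> A"
    and \<pi>_transversal: "\<And>x. x \<in> carrier G \<Longrightarrow> \<pi> (x <# A) \<in> x <# A"
    and \<pi>_one: "\<pi> A = \<one>"
    and \<tau>: "\<And>x y. \<lbrakk>x \<in> carrier G; y \<in> carrier G\<rbrakk> \<Longrightarrow>
      \<pi> ((x \<otimes> y) <# A) = (\<pi> (x <# A) \<otimes> \<pi> (y <# A)) \<otimes> (h [^] \<tau> (x <# A) (y <# A))"
    and \<eta>: "\<eta> = (\<lambda>X Y. h [^] (- \<tau> X Y))"
    and \<eta>s: "\<eta>s = dih_eta_star G S m \<alpha> e f h A \<eta>"
  shows
    \<comment> \<open>\<open>Q\<close> is the quotient of both \<open>G\<close> and \<open>Gs\<close> by \<open>A\<close>; the records themselves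
        may only differ in the set product outside of the carrier\<close>
    "normal_subloop A G \<and> normal_subloop A Gs \<and> carrier (Gs Mod A) = carrier Q \<and>
     (\<forall>X\<in>carrier Q. \<forall>Y\<in>carrier Q. X \<otimes>\<^bsub>Gs Mod A\<^esub> Y = X \<otimes>\<^bsub>Q\<^esub> Y) \<and>
     moufang_factor_set Q (G\<lparr>carrier := A\<rparr>) \<phi> \<eta> \<and>
     moufang_factor_set Q (G\<lparr>carrier := A\<rparr>) \<phi> \<eta>s \<and>
     (\<exists>\<mu>. associative_factor_set Q (G\<lparr>carrier := A\<rparr>) \<phi> \<mu> \<and>
        (\<forall>X\<in>carrier Q. \<forall>Y\<in>carrier Q. \<eta>s X Y = \<eta> X Y \<otimes> \<mu> X Y) \<and>
        (\<forall>u\<in>carrier Q. \<forall>v\<in>carrier Q. \<forall>w\<in>carrier Q.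
           \<mu> (inv\<^bsub>Q\<^esub> (u \<otimes>\<^bsub>Q\<^esub> (v \<otimes>\<^bsub>Q\<^esub> w))) ((u \<otimes>\<^bsub>Q\<^esub> v) \<otimes>\<^bsub>Q\<^esub> w) =
           \<phi> ((u \<otimes>\<^bsub>Q\<^esub> v) \<otimes>\<^bsub>Q\<^esub> w)
             (\<mu> (u \<otimes>\<^bsub>Q\<^esub> (v \<otimes>\<^bsub>Q\<^esub> w)) (inv\<^bsub>Q\<^esub> (u \<otimes>\<^bsub>Q\<^esub> (v \<otimes>\<^bsub>Q\<^esub> w)))))) \<and>
     moufang_loop Gs \<and>
     (\<forall>x\<in>carrier G. \<forall>y\<in>carrier G. \<forall>z\<in>carrier G.
        associator G x y z = associator Gs x y z) \<and>
     associator_subloop G = associator_subloop Gs \<and>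
     (\<forall>x\<in>associator_subloop G. \<forall>y\<in>associator_subloop G. x \<otimes>\<^bsub>G\<^esub> y = x \<otimes>\<^bsub>Gs\<^esub> y) \<and>
     nucleus G = nucleus Gs"
proof -
  interpret dihedral_condition G S m \<beta> \<gamma> h
    by (rule D)
  interpret dihedral_twist G m h kap eps Gs
  proof
    fix x y assume "x \<in> carrier G" "y \<in> carrier G"
    then show "x \<otimes>\<^bsub>Gs\<^esub> y = ix.shift (x \<otimes> y) (ix.cocycle x y)"
      by (simp add: Gs \<alpha> dihedral_construction_def dih_mult_eq[OF e f])
  qed (simp_all add: Gs dihedral_construction_def)
  have A': "A = ix.cyc"
    by (simp only: A ix.subloop_generated_h)
  have Q': "Q = G Mod ix.cyc"
    by (simp only: Q A')
  note transversal = \<pi>_transversal[unfolded A']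
  have action: "\<phi> (x <# ix.cyc) (h [^] (a :: int)) = h [^] (eps x * a)" if "x \<in> carrier G" for x a
    unfolding \<phi> \<alpha> A' by (rule dih_action_eq[OF that])
  define C where "C = (\<lambda>X Y. ix.cocycle (\<pi> X) (\<pi> Y))"
  define \<mu> where \<mu>: "\<mu> = (\<lambda>X Y. h [^] C X Y)"
  have C: "C (x <# ix.cyc) (y <# ix.cyc) = ix.cocycle x y" if "x \<in> carrier G" "y \<in> carrier G" for x y
    unfolding C_def using transversal that by (rule ix.cocycle_transversal)
  have \<eta>s_eq: "\<eta>s X Y = h [^] (- \<tau> X Y + C X Y)" if XY: "X \<in> carrier Q" "Y \<in> carrier Q" for X Y
  proof -
    obtain x y where "x \<in> carrier G" "X = x <# ix.cyc" "y \<in> carrier G" "Y = y <# ix.cyc"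
      using XY unfolding Q' ix.quotient_carrier by blast
    then show ?thesis
      unfolding \<eta>s \<alpha> A' \<eta> by (simp only: dih_eta_star_eq[OF e f] C ix.pow_add)
  qed
  \<comment> \<open>The doubled minus sign presents the defining relation of \<open>\<tau>\<close>
    in the form used for a transversal with exponent function -\<open>\<tau>\<close>, the exponent
    of \<open>\<eta>\<close>.\<close>
  have \<pi>_mult: "\<pi> ((x \<otimes> y) <# ix.cyc) =
      ix.shift (\<pi> (x <# ix.cyc) \<otimes> \<pi> (y <# ix.cyc)) (- (- \<tau> (x <# ix.cyc) (y <# ix.cyc)))"
    if "x \<in> carrier G" "y \<in> carrier G" for x y
    using \<tau>[OF that] by (simp add: ix.shift_def A')
  have exps: "x \<in> carrier G \<Longrightarrow> h [^] T x \<one> = \<one>" "x \<in> carrier G \<Longrightarrow> h [^] T \<one> x = \<one>"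
    "\<lbrakk>x \<in> carrier G; y \<in> carrier G; z \<in> carrier G\<rbrakk> \<Longrightarrow>
      h [^] (eps (x \<otimes> z) * T x y + eps z * T (x \<otimes> y) x + T ((x \<otimes> y) \<otimes> x) z) =
      h [^] (T x z + T y (x \<otimes> z) + T x (y \<otimes> (x \<otimes> z)))"
    if T: "\<And>x y. T x y = - \<tau> (x <# ix.cyc) (y <# ix.cyc)" for T x y z
  proof -
    note prems = transversal \<pi>_one[unfolded A'] \<pi>_mult T
    show "x \<in> carrier G \<Longrightarrow> h [^] T x \<one> = \<one>"
      using prems by (rule ix.transversal_exponents(1))
    show "x \<in> carrier G \<Longrightarrow> h [^] T \<one> x = \<one>"
      using prems by (rule ix.transversal_exponents(2))
    show "\<lbrakk>x \<in> carrier G; y \<in> carrier G; z \<in> carrier G\<rbrakk> \<Longrightarrow>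
      h [^] (eps (x \<otimes> z) * T x y + eps z * T (x \<otimes> y) x + T ((x \<otimes> y) \<otimes> x) z) =
      h [^] (T x z + T y (x \<otimes> z) + T x (y \<otimes> (x \<otimes> z)))"
      using prems by (rule ix.transversal_exponents(3))
  qed
  have C_one: "C (x <# ix.cyc) (\<one> <# ix.cyc) = 0" "C (\<one> <# ix.cyc) (x <# ix.cyc) = 0"
    if "x \<in> carrier G" for x
    using that by (simp_all add: C one_in)
  have \<eta>_moufang: "moufang_factor_set Q (G\<lparr>carrier := A\<rparr>) \<phi> \<eta>"
    unfolding Q' A' \<eta>
    by (rule ix.moufang_factor_set_powI[OF _ _ _ refl])
      (rule action exps[OF refl]; assumption)+
  have "moufang_factor_set Q (G\<lparr>carrier := A\<rparr>) \<phi> (\<lambda>X Y. h [^] (- \<tau> X Y + C X Y))"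
    unfolding Q' A'
  proof (rule ix.moufang_factor_set_powI[OF _ _ _ refl])
    fix x and a :: int assume "x \<in> carrier G"
    then show "\<phi> (x <# ix.cyc) (h [^] a) = h [^] (eps x * a)"
      by (rule action)
  next
    fix x assume x: "x \<in> carrier G"
    show "h [^] (- \<tau> (x <# ix.cyc) (\<one> <# ix.cyc) + C (x <# ix.cyc) (\<one> <# ix.cyc)) = \<one>"
      "h [^] (- \<tau> (\<one> <# ix.cyc) (x <# ix.cyc) + C (\<one> <# ix.cyc) (x <# ix.cyc)) = \<one>"
      using exps(1,2)[OF refl x] by (simp_all only: C_one[OF x] add_0_right)
  next
    fix x y z assume xyz: "x \<in> carrier G" "y \<in> carrier G" "z \<in> carrier G"
    \<comment> \<open>The identity for -\<open>\<tau>\<close> holds only between powers of h, the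
      one for the cocycle between integers. The exponent is regrouped so that each applies to its
      own factor.\<close>
    define T where "T = (\<lambda>x y. - \<tau> (x <# ix.cyc) (y <# ix.cyc))"
    let ?c = ix.cocycle
    have "eps (x \<otimes> z) * (T x y + ?c x y) + eps z * (T (x \<otimes> y) x + ?c (x \<otimes> y) x) +
        (T ((x \<otimes> y) \<otimes> x) z + ?c ((x \<otimes> y) \<otimes> x) z) =
      (eps (x \<otimes> z) * T x y + eps z * T (x \<otimes> y) x + T ((x \<otimes> y) \<otimes> x) z) +
        (eps (x \<otimes> z) * ?c x y + eps z * ?c (x \<otimes> y) x + ?c ((x \<otimes> y) \<otimes> x) z)"
      by (simp only: distrib_left add_ac)
    then have "h [^] (eps (x \<otimes> z) * (T x y + ?c x y) + eps z * (T (x \<otimes> y) x + ?c (x \<otimes> y) x) +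
        (T ((x \<otimes> y) \<otimes> x) z + ?c ((x \<otimes> y) \<otimes> x) z)) =
      h [^] (eps (x \<otimes> z) * T x y + eps z * T (x \<otimes> y) x + T ((x \<otimes> y) \<otimes> x) z) \<otimes>
        h [^] (eps (x \<otimes> z) * ?c x y + eps z * ?c (x \<otimes> y) x + ?c ((x \<otimes> y) \<otimes> x) z)"
      by (simp only: ix.pow_add)
    also have "\<dots> = h [^] (T x z + T y (x \<otimes> z) + T x (y \<otimes> (x \<otimes> z))) \<otimes>
        h [^] (?c x z + ?c y (x \<otimes> z) + ?c x (y \<otimes> (x \<otimes> z)))"
      using exps(3)[of T, OF _ xyz] unfolding ix.cocycle_moufang[OF xyz] by (simp only: T_def)
    also have "\<dots> = h [^] ((T x z + ?c x z) + (T y (x \<otimes> z) + ?c y (x \<otimes> z)) +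
        (T x (y \<otimes> (x \<otimes> z)) + ?c x (y \<otimes> (x \<otimes> z))))"
      unfolding ix.pow_add[symmetric] by (simp only: add_ac)
    finally show "h [^] (eps (x \<otimes> z) * (- \<tau> (x <# ix.cyc) (y <# ix.cyc) + C (x <# ix.cyc) (y <# ix.cyc)) +
        eps z * (- \<tau> ((x \<otimes> y) <# ix.cyc) (x <# ix.cyc) + C ((x \<otimes> y) <# ix.cyc) (x <# ix.cyc)) +
        (- \<tau> (((x \<otimes> y) \<otimes> x) <# ix.cyc) (z <# ix.cyc) + C (((x \<otimes> y) \<otimes> x) <# ix.cyc) (z <# ix.cyc))) =
      h [^] ((- \<tau> (x <# ix.cyc) (z <# ix.cyc) + C (x <# ix.cyc) (z <# ix.cyc)) +
        (- \<tau> (y <# ix.cyc) ((x \<otimes> z) <# ix.cyc) + C (y <# ix.cyc) ((x \<otimes> z) <# ix.cyc)) +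
        (- \<tau> (x <# ix.cyc) ((y \<otimes> (x \<otimes> z)) <# ix.cyc) + C (x <# ix.cyc) ((y \<otimes> (x \<otimes> z)) <# ix.cyc)))"
      by (simp only: T_def C xyz mult_in)
  qed
  then have \<eta>s_moufang: "moufang_factor_set Q (G\<lparr>carrier := A\<rparr>) \<phi> \<eta>s"
    by (rule moufang_factor_set_cong) (rule \<eta>s_eq)
  have \<mu>_assoc: "associative_factor_set Q (G\<lparr>carrier := A\<rparr>) \<phi> \<mu>"
    unfolding Q' A' \<mu>
    by (rule ix.associative_factor_set_powI[OF _ _ _ refl])
      (simp_all only: action C_one C mult_in ix.cocycle_assoc int_pow_0)
  have \<eta>s_\<mu>: "\<eta>s X Y = \<eta> X Y \<otimes> \<mu> X Y" if "X \<in> carrier Q" "Y \<in> carrier Q" for X Y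
    unfolding \<eta>s_eq[OF that] \<eta> \<mu> by (rule ix.pow_add)
  have \<mu>_inv: "\<mu> (inv\<^bsub>Q\<^esub> (u \<otimes>\<^bsub>Q\<^esub> (v \<otimes>\<^bsub>Q\<^esub> w))) ((u \<otimes>\<^bsub>Q\<^esub> v) \<otimes>\<^bsub>Q\<^esub> w) =
      \<phi> ((u \<otimes>\<^bsub>Q\<^esub> v) \<otimes>\<^bsub>Q\<^esub> w)
        (\<mu> (u \<otimes>\<^bsub>Q\<^esub> (v \<otimes>\<^bsub>Q\<^esub> w)) (inv\<^bsub>Q\<^esub> (u \<otimes>\<^bsub>Q\<^esub> (v \<otimes>\<^bsub>Q\<^esub> w))))"
    if "u \<in> carrier Q" "v \<in> carrier Q" "w \<in> carrier Q" for u v w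
    using transversal action \<mu>[unfolded C_def] Q' that by (rule ix.cocycle_inverse_quotient)
  have factor: "associative_factor_set Q (G\<lparr>carrier := A\<rparr>) \<phi> \<mu> \<and>
      (\<forall>X\<in>carrier Q. \<forall>Y\<in>carrier Q. \<eta>s X Y = \<eta> X Y \<otimes> \<mu> X Y) \<and>
      (\<forall>u\<in>carrier Q. \<forall>v\<in>carrier Q. \<forall>w\<in>carrier Q.
         \<mu> (inv\<^bsub>Q\<^esub> (u \<otimes>\<^bsub>Q\<^esub> (v \<otimes>\<^bsub>Q\<^esub> w))) ((u \<otimes>\<^bsub>Q\<^esub> v) \<otimes>\<^bsub>Q\<^esub> w) =
         \<phi> ((u \<otimes>\<^bsub>Q\<^esub> v) \<otimes>\<^bsub>Q\<^esub> w)
           (\<mu> (u \<otimes>\<^bsub>Q\<^esub> (v \<otimes>\<^bsub>Q\<^esub> w)) (inv\<^bsub>Q\<^esub> (u \<otimes>\<^bsub>Q\<^esub> (v \<otimes>\<^bsub>Q\<^esub> w)))))"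
    by (intro conjI ballI) (fact \<mu>_assoc | rule \<eta>s_\<mu> \<mu>_inv; assumption)+
  have subloop_mult: "x \<otimes> y = x \<otimes>\<^bsub>Gs\<^esub> y"
    if x: "x \<in> associator_subloop G" and y: "y \<in> associator_subloop G" for x y
    using subsetD[OF associator_subloop_kernel x] subsetD[OF associator_subloop_kernel y]
    by (intro twist_mult_kernel(1)[symmetric]) (simp_all add: ix.kernel_def)
  have quotient: "normal_subloop A G" "normal_subloop A Gs" "carrier (Gs Mod A) = carrier Q"
    "\<forall>X\<in>carrier Q. \<forall>Y\<in>carrier Q. X \<otimes>\<^bsub>Gs Mod A\<^esub> Y = X \<otimes>\<^bsub>Q\<^esub> Y"
    unfolding A' Q' using ix.cyc_normal cyc_normal_twist quotient_carrier_twist quotient_mult_twist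
    by simp_all
  show ?thesis
    by (intro conjI exI[of _ \<mu>] quotient \<eta>_moufang \<eta>s_moufang factor[THEN conjunct1]
        factor[THEN conjunct2, THEN conjunct1] factor[THEN conjunct2, THEN conjunct2]
        twist_moufang ballI twist_associator[symmetric] associator_subloop_twist[symmetric]
        nucleus_twist[symmetric] subloop_mult)
qed

end
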